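(* Let $d\ge 2$, let $M\in GL_d(\mathbb{Z})$ with $\rho(M)>1$, and let $m$ be any positive real number. Let $E_m=E_m\big((\mathbb{C}^* )^d,M\big)$, with fibration map $p:E_m\to A_m$. If the characteristic polynomial of $M$ is irreducible over $\mathbb{Z}$ and $m\log\rho(M)>2\pi^2$, then $p$ induces an isomorphism between the holomorphic functions on $A_m$ and those on $E_m$, i.e. the pull-back $p^*:\mathcal{O}(A_m)\to\mathcal{O}(E_m)$, $g\mapsto g\circ p$, is an isomorphism.
   Context: For $M\in GL_d(\mathbb{Z})$, $\varphi_M$ is the automorphism of $(\mathbb{C}^* )^d$ given by $\varphi_M(z_1,\dots,z_d)=(w_1,\dots,w_d)$ with $w_i=z_1^{M_{i1}}\cdots z_d^{M_{id}}$. It induces a $\mathbb{Z}$-action on $(\mathbb{C}^* )^d$, written $j.z=\varphi_M^{\,j}(z)$ for $j\in\mathbb{Z}$. For real $m>0$ let $S_m=\{w\in\mathbb{C} : |\mathrm{Im}\, w|<\frac{m}{4\pi}\}$, with the $\mathbb{Z}$-action generated by $w\mapsto w+1$; the quotient $S_m/\mathbb{Z}$ is isomorphic to, and identified with, the annulus $A_m=\{w\in\mathbb{C} : 1<|w|<e^m\}$. $E_m\big((\mathbb{C}^* )^d,M\big)$ is the quotient complex manifold $(S_m\times(\mathbb{C}^* )^d)/\mathbb{Z}$ for the free, properly discontinuous diagonal action $j.(w,z)=(w+j,\,j.z)$. The projection $S_m\times(\mathbb{C}^* )^d\to S_m$ induces the locally trivial fibration $p:E_m\to A_m$ with fiber $(\mathbb{C}^*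 )^d$. $\rho(M)$ denotes the maximum of the spectral radii of $M$ and $M^{-1}$. $\mathcal{O}(X)$ denotes the algebra of holomorphic functions on $X$. *)

theory Defs
  imports
    "HOL-Analysis.Analysis"
    "HOL-Algebra.QuotRing"
    "HOL-Algebra.Module"
    "HOL-Computational_Algebra.Polynomial"
begin

section \<open>Characteristic polynomial and spectral radius\<close>

text \<open>The AFP entry Jordan_Normal_Form has these notions for its own matrix type, whose dimension is
  a number; here they are stated for matrices indexed by a finite type.\<close>

definition char_poly :: "'a::comm_ring_1^'n^'n \<Rightarrow> 'a poly" where
  "char_poly A = det (\<chi> i j. (if i = j then [:0, 1:] else 0) - [:A $ i $ j:])"

definition spectrum :: "complex^'n^'n \<Rightarrow> complex set" where
  "spectrum A = {k. \<exists>v. v \<noteq> 0 \<and> A *v v = k *s v}"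

definition spectral_radius :: "complex^'n^'n \<Rightarrow> real" where
  "spectral_radius A = Max (cmod ` spectrum A)"

definition rho :: "int^'n^'n \<Rightarrow> real" where
  "rho M = max (spectral_radius (map_matrix of_int M))
               (spectral_radius (map_matrix of_int (matrix_inv M)))"


section \<open>The action on the torus\<close>

definition torus :: "(complex^'n) set" where
  "torus = {z. \<forall>i. z $ i \<noteq> 0}"

definition phi :: "int^'n^'n \<Rightarrow> complex^'n \<Rightarrow> complex^'n" where
  "phi M z = (\<chi> i. \<Prod>j\<in>UNIV. z $ j powi (M $ i $ j))"

text \<open>The power \<open>f\<^sup>j\<close>, \<open>j\<close> an integer, of a bijection \<open>f\<close> from \<open>T\<close> to \<open>T\<close>.\<close>

definition int_iter :: "'a set \<Rightarrow> ('a \<Rightarrow> 'a) \<Rightarrow> int \<Rightarrow> 'a \<Rightarrow> 'a" where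
  "int_iter T f j = (if 0 \<le> j then f ^^ nat j else inv_into T f ^^ nat (- j))"

definition torus_act :: "int^'n^'n \<Rightarrow> int \<Rightarrow> complex^'n \<Rightarrow> complex^'n" where
  "torus_act M j = int_iter torus (phi M) j"


section \<open>The quotient manifold\<close>

definition strip :: "real \<Rightarrow> complex set" where
  "strip m = {w. \<bar>Im w\<bar> < m / (4 * pi)}"

definition annulus :: "real \<Rightarrow> complex set" where
  "annulus m = {w. 1 < cmod w \<and> cmod w < exp m}"

text \<open>The covering of the annulus by the strip: it is \<open>1\<close>-periodic, and the factor \<open>exp (m/2)\<close>
  moves the annulus \<open>exp (-m/2) < \<bar>w\<bar> < exp (m/2)\<close> to \<open>annulus m\<close>.\<close>

definition strip_to_annulus :: "real \<Rightarrow> complex \<Rightarrow> complex" where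
  "strip_to_annulus m w = exp (2 * of_real pi * \<i> * w + of_real (m / 2))"

type_synonym 'n cover = "complex \<times> (complex^'n)"

definition orbit_rel :: "real \<Rightarrow> int^'n^'n \<Rightarrow>
    ('n cover \<times> 'n cover) set" where
  "orbit_rel m M = {((w, z), (w', z')). w \<in> strip m \<and> z \<in> torus \<and>
     (\<exists>j::int. w' = w + of_int j \<and> z' = torus_act M j z)}"

definition E :: "real \<Rightarrow> int^'n^'n \<Rightarrow> 'n cover set set" where
  "E m M = (strip m \<times> torus) // orbit_rel m M"

definition E_class :: "real \<Rightarrow> int^'n^'n \<Rightarrow> 'n cover \<Rightarrow> 'n cover set" where
  "E_class m M x = orbit_rel m M `` {x}"

definition E_proj :: "real \<Rightarrow> 'n cover set \<Rightarrow> complex" where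
  "E_proj m X = the_elem ((\<lambda>(w, z). strip_to_annulus m w) ` X)"

text \<open>A chart is a pair of its domain and its coordinate map. The complex structure of the
  quotient is given by the local inverses of the quotient map.\<close>

definition E_atlas :: "real \<Rightarrow> int^'n^'n \<Rightarrow>
    ('n cover set set \<times> ('n cover set \<Rightarrow> 'n cover)) set" where
  "E_atlas m M = {(E_class m M ` V, inv_into V (E_class m M)) | V.
     open V \<and> V \<subseteq> strip m \<times> torus \<and> inj_on (E_class m M) V}"


section \<open>Holomorphic functions\<close>

text \<open>Several complex variables: the real Frechet derivative exists and is complex linear.\<close>

definition holomorphic_several_on ::
    "('n::finite cover \<Rightarrow> complex) \<Rightarrow> 'n cover set \<Rightarrow> bool" where
  "holomorphic_several_on f U \<longleftrightarrow> (\<forall>x\<in>U. \<exists>f'. (f has_derivative f') (at x within U) \<and>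
     (\<forall>c h k. f' (c * h, c *s k) = c * f' (h, k)))"

definition holomorphic_wrt ::
    "('x set \<times> ('x \<Rightarrow> 'n::finite cover)) set \<Rightarrow> ('x \<Rightarrow> complex) \<Rightarrow> bool" where
  "holomorphic_wrt atlas f \<longleftrightarrow>
     (\<forall>(U, \<psi>)\<in>atlas. holomorphic_several_on (f \<circ> inv_into U \<psi>) (\<psi> ` U))"

text \<open>Elements of the function algebras are extensional, so that equality of functions is equality
  on the space.\<close>

definition fun_algebra :: "'x set \<Rightarrow> (('x \<Rightarrow> complex) \<Rightarrow> bool) \<Rightarrow> (complex, 'x \<Rightarrow> complex) module" where
  "fun_algebra X P = \<lparr>carrier = {f \<in> extensional X. P f},
     mult = (\<lambda>f g. \<lambda>x\<in>X. f x * g x), one = (\<lambda>x\<in>X. 1),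
     zero = (\<lambda>x\<in>X. 0), add = (\<lambda>f g. \<lambda>x\<in>X. f x + g x),
     smult = (\<lambda>c f. \<lambda>x\<in>X. c * f x)\<rparr>"

definition O_annulus :: "real \<Rightarrow> (complex, complex \<Rightarrow> complex) module" where
  "O_annulus m = fun_algebra (annulus m) (\<lambda>g. g holomorphic_on annulus m)"

definition O_E :: "real \<Rightarrow> int^'n^'n \<Rightarrow> (complex, 'n cover set \<Rightarrow> complex) module" where
  "O_E m M = fun_algebra (E m M) (holomorphic_wrt (E_atlas m M))"

definition algebra_iso :: "(complex, 'a) module \<Rightarrow> (complex, 'b) module \<Rightarrow> ('a \<Rightarrow> 'b) set" where
  "algebra_iso A B = {h \<in> ring_iso A B. \<forall>c. \<forall>a\<in>carrier A. h (c \<odot>\<^bsub>A\<^esub> a) = c \<odot>\<^bsub>B\<^esub> h a}"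


section \<open>The quotient is well defined\<close>

lemma strip_to_annulus_eq_iff:
  "strip_to_annulus m w = strip_to_annulus m w' \<longleftrightarrow> (\<exists>j::int. w' = w + of_int j)"
proof -
  have "strip_to_annulus m w' = strip_to_annulus m w \<longleftrightarrow>
      (\<exists>j::int. 2 * of_real pi * \<i> * w' = 2 * of_real pi * \<i> * w + of_int (2 * j) * of_real pi * \<i>)"
    unfolding strip_to_annulus_def exp_eq by (simp add: algebra_simps)
  also have "\<dots> \<longleftrightarrow> (\<exists>j::int. w' = w + of_int j)"
  proof -
    have "2 * of_real pi * \<i> * w' = 2 * of_real pi * \<i> * w + of_int (2 * j) * of_real pi * \<i>
        \<longleftrightarrow> (2 * of_real pi * \<i>) * w' = (2 * of_real pi * \<i>) * (w + of_int j)" for j :: int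
      by (simp add: algebra_simps)
    then show ?thesis by simp
  qed
  finally show ?thesis by metis
qed

lemma strip_to_annulus_image: "strip_to_annulus m ` strip m = annulus m"
proof -
  have *: "strip_to_annulus m w \<in> annulus m \<longleftrightarrow> w \<in> strip m" for w
    by (simp add: strip_to_annulus_def annulus_def strip_def abs_less_iff field_simps) argo
  have "\<exists>w. y = strip_to_annulus m w" if "y \<in> annulus m" for y
  proof
    have "y \<noteq> 0" using that by (auto simp: annulus_def)
    then show "y = strip_to_annulus m ((Ln y - of_real (m / 2)) / (2 * of_real pi * \<i>))"
      by (simp add: strip_to_annulus_def)
  qed
  then show ?thesis using * by blast
qed

lemma phi_in_torus: "z \<in> torus \<Longrightarrow> phi M z \<in> torus"
  by (auto simp: torus_def phi_def)

lemma powi_prod: "(\<Prod>k\<in>A. f k :: complex) powi n = (\<Prod>k\<in>A. f k powi n)"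
  by (induction A rule: infinite_finite_induct) (auto simp: power_int_mult_distrib)

lemma powi_sum: "x \<noteq> 0 \<Longrightarrow> (x::complex) powi (\<Sum>k\<in>A. f k) = (\<Prod>k\<in>A. x powi f k)"
  by (induction A rule: infinite_finite_induct) (auto simp: power_int_add)

lemma phi_mult:
  assumes "z \<in> torus"
  shows "phi M (phi N z) = phi (M ** N) z"
proof -
  have "(\<Prod>j\<in>UNIV. (\<Prod>k\<in>UNIV. z $ k powi (N $ j $ k)) powi (M $ i $ j)) =
        (\<Prod>k\<in>UNIV. \<Prod>j\<in>UNIV. z $ k powi (M $ i $ j * N $ j $ k))" for i
    by (subst prod.swap) (simp add: powi_prod flip: power_int_mult, simp add: mult.commute)
  also have "\<dots> i = (\<Prod>k\<in>UNIV. z $ k powi (\<Sum>j\<in>UNIV. M $ i $ j * N $ j $ k))" for i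
    using assms by (simp add: powi_sum torus_def)
  finally show ?thesis
    by (simp add: phi_def matrix_matrix_mult_def vec_eq_iff)
qed

lemma phi_one: "phi (mat 1) z = z"
proof -
  have "(\<Prod>j\<in>UNIV. z $ j powi (if i = j then 1 else 0)) = (\<Prod>j\<in>UNIV. if i = j then z $ j else 1)" for i
    by (rule prod.cong) auto
  then show ?thesis by (simp add: phi_def mat_def vec_eq_iff)
qed

lemma bij_betw_phi:
  assumes "invertible M"
  shows "bij_betw (phi M) torus torus"
proof -
  obtain N where "M ** N = mat 1" "N ** M = mat 1"
    using assms by (auto simp: invertible_def)
  then show ?thesis
    by (intro bij_betw_byWitness[where f' = "phi N"]) (auto simp: phi_mult phi_one phi_in_torus)
qed

lemma int_iter_0: "int_iter T f 0 x = x"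
  by (simp add: int_iter_def)

lemma int_iter_in:
  assumes "bij_betw f T T" "x \<in> T"
  shows "int_iter T f j x \<in> T"
proof -
  have "(f ^^ n) x \<in> T" for n
    using assms by (induction n) (auto simp: bij_betw_def)
  moreover have "(inv_into T f ^^ n) x \<in> T" for n
    using assms bij_betw_inv_into[OF assms(1)] by (induction n) (auto simp: bij_betw_def)
  ultimately show ?thesis by (simp add: int_iter_def)
qed

lemma int_iter_Suc:
  assumes "bij_betw f T T" "x \<in> T"
  shows "int_iter T f (j + 1) x = f (int_iter T f j x)"
proof (cases "0 \<le> j")
  case True
  then show ?thesis by (simp add: int_iter_def nat_add_distrib)
next
  case False
  then obtain n where n: "j = - int (Suc n)"
    by (metis int_cases not_le of_nat_0_le_iff)
  have "(inv_into T f ^^ n) x \<in> T" for n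
    using assms bij_betw_inv_into[OF assms(1)] by (induction n) (auto simp: bij_betw_def)
  then show ?thesis
    using assms by (cases "n = 0") (auto simp: n int_iter_def bij_betw_inv_into_right nat_add_distrib)
qed

lemma int_iter_add:
  assumes "bij_betw f T T" "x \<in> T"
  shows "int_iter T f (i + j) x = int_iter T f i (int_iter T f j x)"
proof (induction i rule: int_induct[where k = 0])
  case base
  show ?case by (simp add: int_iter_0)
next
  case (step1 i)
  then show ?case
    using int_iter_Suc[OF assms, of "i + j"] int_iter_Suc[OF assms(1) int_iter_in[OF assms], of i j]
    by (simp add: algebra_simps)
next
  case (step2 i)
  let ?y = "int_iter T f j x"
  have "f (int_iter T f (i - 1 + j) x) = f (int_iter T f (i - 1) ?y)"
    using int_iter_Suc[OF assms, of "i - 1 + j"] step2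
      int_iter_Suc[OF assms(1) int_iter_in[OF assms], of "i - 1" j]
    by (simp add: algebra_simps)
  then show ?case
    using assms by (meson bij_betw_imp_inj_on inj_onD int_iter_in)
qed

lemma strip_add_int: "w + of_int j \<in> strip m \<longleftrightarrow> w \<in> strip m"
  by (simp add: strip_def)

lemma equiv_orbit_rel:
  assumes "invertible M"
  shows "equiv (strip m \<times> torus) (orbit_rel m M)"
proof (rule equivI)
  note [simp] = int_iter_in[OF bij_betw_phi[OF assms]] int_iter_add[OF bij_betw_phi[OF assms]]
  show sub: "orbit_rel m M \<subseteq> (strip m \<times> torus) \<times> (strip m \<times> torus)"
    by (auto simp: orbit_rel_def torus_act_def strip_add_int)
  show "refl_on (strip m \<times> torus) (orbit_rel m M)"
    by (auto simp: refl_on_def orbit_rel_def torus_act_def int_iter_0 intro!: exI[of _ 0])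
  show "sym (orbit_rel m M)"
  proof (rule symI)
    fix x y assume "(x, y) \<in> orbit_rel m M"
    then obtain w z j where *: "x = (w, z)" "w \<in> strip m" "z \<in> torus"
      "y = (w + of_int j, torus_act M j z)"
      by (auto simp: orbit_rel_def)
    have "z = torus_act M (- j) (torus_act M j z)"
      using * int_iter_add[OF bij_betw_phi[OF assms], of z "- j" j]
      by (simp add: torus_act_def int_iter_0)
    then show "(y, x) \<in> orbit_rel m M"
      using * by (auto simp: orbit_rel_def strip_add_int torus_act_def intro!: exI[of _ "- j"])
  qed
  show "trans (orbit_rel m M)"
  proof (rule transI)
    fix x y u assume "(x, y) \<in> orbit_rel m M" "(y, u) \<in> orbit_rel m M"
    then obtain w z i j where "x = (w, z)" "w \<in> strip m" "z \<in> torus"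
      "u = (w + of_int i + of_int j, torus_act M j (torus_act M i z))"
      by (auto simp: orbit_rel_def)
    then show "(x, u) \<in> orbit_rel m M"
      by (auto simp: orbit_rel_def torus_act_def simp del: of_int_add intro!: exI[of _ "j + i"])
        (simp add: algebra_simps)
  qed
qed

lemma E_eq: "E m M = E_class m M ` (strip m \<times> torus)"
  by (auto simp: E_def E_class_def quotient_def)

lemma E_proj_class:
  assumes "invertible M" "w \<in> strip m" "z \<in> torus"
  shows "E_proj m (E_class m M (w, z)) = strip_to_annulus m w"
proof -
  let ?X = "E_class m M (w, z)"
  have "(\<lambda>(w, z). strip_to_annulus m w) ` ?X = (\<lambda>_. strip_to_annulus m w) ` ?X"
  proof (rule image_cong[OF refl])
    fix u assume "u \<in> ?X"
    then obtain j :: int where "fst u = w + of_int j" by (auto simp: E_class_def orbit_rel_def)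
    then show "(case u of (w, z) \<Rightarrow> strip_to_annulus m w) = strip_to_annulus m w"
      using strip_to_annulus_eq_iff[of m w "fst u"] by (auto simp: case_prod_beta)
  qed
  moreover have "(w, z) \<in> ?X"
    using equiv_class_self[OF equiv_orbit_rel[OF assms(1)]] assms by (auto simp: E_class_def)
  ultimately have "(\<lambda>(w, z). strip_to_annulus m w) ` ?X = {strip_to_annulus m w}"
    by (metis empty_iff image_constant)
  then show ?thesis by (simp add: E_proj_def)
qed

lemma E_proj_image:
  assumes "invertible M"
  shows "E_proj m ` E m M = annulus m"
proof -
  have "(\<chi> i. 1) \<in> torus" by (simp add: torus_def)
  then have "E_proj m ` E m M = strip_to_annulus m ` strip m"
    unfolding E_eq using E_proj_class[OF assms] by force
  then show ?thesis by (simp add: strip_to_annulus_image)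
qed

lemma open_strip: "open (strip m)"
  unfolding strip_def by (intro open_Collect_less continuous_intros)

lemma open_torus: "open (torus :: (complex^'n) set)"
proof -
  have "torus = (\<Inter>i. {z::complex^'n. z $ i \<noteq> 0})" by (auto simp: torus_def)
  moreover have "open {z::complex^'n. z $ i \<noteq> 0}" for i
    by (intro open_Collect_neq continuous_intros)
  ultimately show ?thesis by (metis (no_types, lifting) finite open_INT)
qed

text \<open>The domains of the charts cover the quotient, so holomorphy with respect to the atlas is
  not vacuous.\<close>

lemma E_class_locally_inj:
  fixes M :: "int^'n^'n"
  assumes "invertible M" "x \<in> strip m \<times> torus"
  obtains V where "x \<in> V" "open V" "V \<subseteq> strip m \<times> torus" "inj_on (E_class m M) V"
proof
  let ?V = "(strip m \<inter> ball (fst x) (1/2)) \<times> torus :: 'n cover set"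
  show "x \<in> ?V" using assms(2) by auto
  show "open ?V" by (intro open_Times open_Int open_strip open_ball open_torus)
  show "?V \<subseteq> strip m \<times> torus" by auto
  show "inj_on (E_class m M) ?V"
  proof (rule inj_onI)
    fix a b assume ab: "a \<in> ?V" "b \<in> ?V" "E_class m M a = E_class m M b"
    then have "(a, b) \<in> orbit_rel m M"
      using eq_equiv_class[OF _ equiv_orbit_rel[OF assms(1), of m]]
      by (auto simp: E_class_def)
    then obtain j where j: "fst b = fst a + of_int j" "snd b = torus_act M j (snd a)"
      by (auto simp: orbit_rel_def)
    have "dist (fst a) (fst b) < 1"
      using ab(1,2) dist_triangle_half_r[of "fst x" "fst a" 1 "fst b"] by auto
    then have "j = 0" using j(1) by (simp add: dist_norm)
    then show "a = b" using j by (simp add: torus_act_def int_iter_0 prod_eq_iff)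
  qed
qed

lemma holomorphic_several_on_cong:
  assumes "\<And>x. x \<in> U \<Longrightarrow> f x = g x"
  shows "holomorphic_several_on f U \<longleftrightarrow> holomorphic_several_on g U"
proof -
  have "(f has_derivative f') (at x within U) \<longleftrightarrow> (g has_derivative f') (at x within U)" if "x \<in> U" for x f'
    using has_derivative_transform[OF that, of f g f'] has_derivative_transform[OF that, of g f f'] assms
    by auto
  then show ?thesis by (simp add: holomorphic_several_on_def)
qed

lemma holomorphic_E_iff:
  fixes M :: "int^'n^'n"
  assumes "invertible M"
  shows "holomorphic_wrt (E_atlas m M) f \<longleftrightarrow>
    holomorphic_several_on (f \<circ> E_class m M) (strip m \<times> torus)"
proof -
  let ?\<pi> = "E_class m M"
  have chart: "holomorphic_several_on (f \<circ> inv_into (?\<pi> ` V) (inv_into V ?\<pi>)) (inv_into V ?\<pi> ` (?\<pi> ` V))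
      \<longleftrightarrow> holomorphic_several_on (f \<circ> ?\<pi>) V" if "inj_on ?\<pi> V" for V
  proof -
    have inj: "inj_on (inv_into V ?\<pi>) (?\<pi> ` V)" by (simp add: inj_on_inv_into)
    have "inv_into V ?\<pi> ` (?\<pi> ` V) = V" using that by (force simp: image_iff)
    moreover have "inv_into (?\<pi> ` V) (inv_into V ?\<pi>) x = ?\<pi> x" if "x \<in> V" for x
      using inv_into_f_f[OF inj, of "?\<pi> x"] that \<open>inj_on ?\<pi> V\<close> by simp
    ultimately show ?thesis using holomorphic_several_on_cong by (metis comp_apply)
  qed
  have "holomorphic_wrt (E_atlas m M) f \<longleftrightarrow> (\<forall>V. open V \<and> V \<subseteq> strip m \<times> torus \<and> inj_on ?\<pi> V \<longrightarrow>
      holomorphic_several_on (f \<circ> ?\<pi>) V)"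
  proof -
    have "holomorphic_wrt (E_atlas m M) f \<longleftrightarrow> (\<forall>V. open V \<and> V \<subseteq> strip m \<times> torus \<and> inj_on ?\<pi> V \<longrightarrow>
        holomorphic_several_on (f \<circ> inv_into (?\<pi> ` V) (inv_into V ?\<pi>)) (inv_into V ?\<pi> ` (?\<pi> ` V)))"
      unfolding holomorphic_wrt_def E_atlas_def by blast
    then show ?thesis using chart by meson
  qed
  also have "\<dots> \<longleftrightarrow> holomorphic_several_on (f \<circ> ?\<pi>) (strip m \<times> torus)"
  proof
    assume *: "\<forall>V. open V \<and> V \<subseteq> strip m \<times> torus \<and> inj_on ?\<pi> V \<longrightarrow> holomorphic_several_on (f \<circ> ?\<pi>) V"
    show "holomorphic_several_on (f \<circ> ?\<pi>) (strip m \<times> torus)"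
      unfolding holomorphic_several_on_def
    proof
      fix x :: "'n cover" assume x: "x \<in> strip m \<times> torus"
      then obtain V where V: "x \<in> V" "open V" "V \<subseteq> strip m \<times> torus" "inj_on ?\<pi> V"
        using E_class_locally_inj[OF assms] by blast
      then obtain f' where "((f \<circ> ?\<pi>) has_derivative f') (at x within V)"
        "\<forall>c h k. f' (c * h, c *s k) = c * f' (h, k)"
        using *[THEN spec, of V] unfolding holomorphic_several_on_def by blast
      then show "\<exists>f'. ((f \<circ> ?\<pi>) has_derivative f') (at x within strip m \<times> torus) \<and>
          (\<forall>c h k. f' (c * h, c *s k) = c * f' (h, k))"
        using V(1,2) by (metis at_within_open has_derivative_at_withinI)
    qed
  next
    assume *: "holomorphic_several_on (f \<circ> ?\<pi>) (strip m \<times> torus)"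
    have "holomorphic_several_on (f \<circ> ?\<pi>) V" if "V \<subseteq> strip m \<times> torus" for V
      using * that has_derivative_subset[OF _ that]
      unfolding holomorphic_several_on_def by blast
    then show "\<forall>V. open V \<and> V \<subseteq> strip m \<times> torus \<and> inj_on ?\<pi> V \<longrightarrow> holomorphic_several_on (f \<circ> ?\<pi>) V"
      by blast
  qed
  finally show ?thesis .
qed

end

(* A holomorphic function on E_m is a function F(w,z) on strip x torus with F(w+1, phi_M z) = F(w,z).
   Let M v = mu v with |mu| = rho(M) = e^L (replace M by its inverse, and w by -w, if necessary). Put r = Im v.
   For real x and R > 0 consider the analytic disc
     eta |-> (x - Ln(1 + eta^2)/L, exp(i R eta/(1 + eta^2) r)),   |eta| < 1.
   Its first component has imaginary part less than pi/(2L), which is less than half the width of the strip exactly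
   because m log rho(M) > 2 pi^2. Its boundary lies over the compact torus, where F is bounded by some B,
   since the compact torus is invariant under phi_M. So |F| <= B on the disc, for every R; the Schwarz lemma
   at eta = 1/R and R -> infinity give F(x, exp(i r)) = F(x, 1). The same holds for every multiple of v.
   Because the characteristic polynomial is irreducible, the entries of v are linearly independent over the
   rationals; so are those of Im(t v) for a suitable complex t, and by Kronecker's theorem exp(i s Im(t v)), s real,
   is dense in the compact torus. By the identity theorem F(w,z) = F(w,1) for all w and z. *)

theory Submission
  imports Defs
    "HOL-Complex_Analysis.Conformal_Mappings"
    "HOL-Computational_Algebra.Polynomial_Factorial"
    "HOL-Computational_Algebra.Fundamental_Theorem_Algebra"
begin

section \<open>Integer characteristic polynomials and their complex roots\<close>

lemma map_poly_of_int_mult: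
  "map_poly of_int (p * q) = (map_poly of_int p * map_poly of_int q :: 'a::field_char_0 poly)"
  by (rule poly_eqI) (simp add: coeff_map_poly coeff_mult)

lemma map_poly_of_int_add:
  "map_poly of_int (p + q) = (map_poly of_int p + map_poly of_int q :: 'a::field_char_0 poly)"
  by (rule poly_eqI) (simp add: coeff_map_poly)

lemma map_poly_of_int_diff:
  "map_poly of_int (p - q) = (map_poly of_int p - map_poly of_int q :: 'a::field_char_0 poly)"
  by (rule poly_eqI) (simp add: coeff_map_poly)

lemma map_poly_of_int_of_int: "map_poly of_int (of_int k) = (of_int k :: 'a::field_char_0 poly)"
  by (simp add: of_int_poly map_poly_pCons)

lemma map_poly_of_int_sum:
  "map_poly of_int (\<Sum>x\<in>A. f x) = (\<Sum>x\<in>A. map_poly of_int (f x) :: 'a::field_char_0 poly)"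
  by (induction A rule: infinite_finite_induct) (auto simp: map_poly_of_int_add)

lemma map_poly_of_int_prod:
  "map_poly of_int (\<Prod>x\<in>A. f x) = (\<Prod>x\<in>A. map_poly of_int (f x) :: 'a::field_char_0 poly)"
  by (induction A rule: infinite_finite_induct) (auto simp: map_poly_of_int_mult map_poly_pCons one_pCons)

lemma map_poly_char_poly:
  "map_poly of_int (char_poly A) = char_poly (map_matrix of_int A :: 'a::field_char_0^'n^'n)"
proof -
  have "map_poly of_int ((if i = j then [:0, 1:] else 0) - [:A $ i $ j:]) =
      (if i = j then [:0, 1:] else 0) - [:of_int (A $ i $ j) :: 'a:]" for i j
    by (simp add: map_poly_pCons map_poly_of_int_diff)
  then show ?thesis
    by (simp add: char_poly_def det_def map_poly_of_int_sum map_poly_of_int_mult map_poly_of_int_of_int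
        map_poly_of_int_prod)
qed

lemma poly_char_poly: "poly (char_poly A) x = det (mat x - A)"
  by (simp add: char_poly_def det_def poly_sum poly_prod mat_def if_distrib[of "\<lambda>p. poly p x"] cong: if_cong)

lemma matrix_kernel_det:
  fixes A :: "'a::field^'n^'n"
  shows "det A = 0 \<longleftrightarrow> (\<exists>v. v \<noteq> 0 \<and> A *v v = 0)"
  using invertible_det_nz[of A] matrix_left_invertible_ker[of A] by (metis invertible_left_inverse)

lemma spectrum_eq_roots: "spectrum A = {k. poly (char_poly A) k = 0}"
proof -
  have "(mat k - A) *v v = k *s v - A *v v" for k :: complex and v
  proof -
    have "mat k *v v = k *s v"
      by (simp add: vec_eq_iff mat_def matrix_vector_mult_def if_distrib[of "\<lambda>x. x * _"] cong: if_cong)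
    then show ?thesis by (simp add: matrix_vector_mult_diff_rdistrib)
  qed
  then have "det (mat k - A) = 0 \<longleftrightarrow> (\<exists>v. v \<noteq> 0 \<and> A *v v = k *s v)" for k
    by (simp add: matrix_kernel_det) metis
  then show ?thesis by (simp add: spectrum_def poly_char_poly)
qed

text \<open>In the Leibniz expansion a permutation other than the identity meets at least one
  constant entry, so its term has degree below n; the identity contributes a product of n linear
  factors.\<close>

lemma degree_char_poly:
  fixes A :: "'a::idom^'n^'n"
  shows "degree (char_poly A) = CARD('n)"
proof -
  define B where "B i j = (if i = j then [:0, 1:] else 0) - [:A $ i $ j:]" for i j
  have deg_B: "degree (B i j) = (if i = j then 1 else 0)" for i j
    by (auto simp: B_def)
  define t where "t p = of_int (sign p) * (\<Prod>i\<in>UNIV. B i (p i))" for p :: "'n \<Rightarrow> 'n"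
  have "degree (t p) < CARD('n)" if p: "p \<noteq> id" for p
  proof -
    obtain i where i: "p i \<noteq> i" using p by (metis eq_id_iff)
    have "degree (t p) = degree (\<Prod>i\<in>UNIV. B i (p i))"
      by (cases "evenperm p") (simp_all add: t_def sign_def)
    also have "\<dots> \<le> (\<Sum>i\<in>UNIV. degree (B i (p i)))" using degree_prod_sum_le[of UNIV "\<lambda>i. B i (p i)"] by (simp add: o_def)
    also have "\<dots> < (\<Sum>i\<in>(UNIV :: 'n set). 1)"
    proof (rule sum_strict_mono_ex1)
      show "\<exists>i\<in>UNIV. degree (B i (p i)) < 1" using i by (intro bexI[of _ i]) (simp_all add: deg_B)
    qed (simp_all add: deg_B)
    finally show ?thesis by simp
  qed
  then have "degree (\<Sum>p\<in>{p. p permutes UNIV} - {id}. t p) < CARD('n)"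
    by (intro degree_sum_less) auto
  moreover have "degree (t id) = CARD('n)"
  proof -
    have "B i i \<noteq> 0" for i using deg_B[of i i] by force
    then show ?thesis by (simp add: t_def degree_prod_eq_sum_degree deg_B)
  qed
  moreover have "char_poly A = t id + (\<Sum>p\<in>{p. p permutes UNIV} - {id}. t p)"
  proof -
    have "char_poly A = (\<Sum>p | p permutes UNIV. t p)"
      by (simp add: char_poly_def det_def t_def B_def)
    also have "\<dots> = t id + (\<Sum>p\<in>{p. p permutes UNIV} - {id}. t p)"
      by (rule sum.remove) (simp_all add: finite_permutations permutes_id)
    finally show ?thesis .
  qed
  ultimately show ?thesis by (simp add: degree_add_eq_left)
qed

text \<open>The spectrum is the root set of a polynomial of positive degree, hence finite and, by
  the fundamental theorem of algebra, non-empty; so the \<open>Max\<close> in the definition is a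
  true maximum.\<close>

lemma spectral_radius_attained:
  fixes A :: "complex^'n^'n"
  obtains k v where "A *v v = k *s v" "v \<noteq> 0" "spectral_radius A = cmod k"
proof -
  have "degree (char_poly A) \<noteq> 0" by (simp add: degree_char_poly)
  then have "char_poly A \<noteq> 0" "\<exists>k. poly (char_poly A) k = 0"
    using fundamental_theorem_of_algebra[of "char_poly A"] by (auto simp: constant_degree)
  then have "finite (cmod ` spectrum A)" "cmod ` spectrum A \<noteq> {}"
    by (auto simp: spectrum_eq_roots poly_roots_finite)
  then have "spectral_radius A \<in> cmod ` spectrum A"
    unfolding spectral_radius_def by (rule Max_in)
  then show thesis using that by (auto simp: spectrum_def)
qed

section \<open>Rational independence of the entries of an eigenvector\<close>

text \<open>These are n + 1 vectors in a space of dimension n. They form a family and not a set, so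
  a repeated vector is a dependency of its own and is treated separately.\<close>

lemma rat_vec_dependent:
  fixes w :: "nat \<Rightarrow> rat^'n"
  obtains c :: "nat \<Rightarrow> rat" where "(\<Sum>i\<le>CARD('n). c i *s w i) = 0" "\<exists>i\<le>CARD('n). c i \<noteq> 0"
proof (cases "inj_on w {..CARD('n)}")
  case True
  have "vec.dim (w ` {..CARD('n)}) \<le> CARD('n)"
    by (rule dim_subset_UNIV_cart_gen)
  then have "vec.dependent (w ` {..CARD('n)})"
    by (intro vec.dependent_biggerset_general) (simp add: card_image[OF True])
  then obtain u where "\<exists>x\<in>w ` {..CARD('n)}. u x \<noteq> 0" "(\<Sum>x\<in>w ` {..CARD('n)}. u x *s x) = 0"
    by (auto simp: vec.dependent_finite)
  then show thesis
    using that[of "\<lambda>i. u (w i)"] True by (auto simp: sum.reindex)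
next
  case False
  then obtain i j where *: "i \<le> CARD('n)" "j \<le> CARD('n)" "i \<noteq> j" "w i = w j"
    by (auto simp: inj_on_def)
  let ?c = "\<lambda>l. (if l = i then 1 else 0) - (if l = j then 1 else 0) :: rat"
  have "?c l *s w l = (if l = i then w l else 0) - (if l = j then w l else 0)" for l
    by (simp add: vec.scale_left_diff_distrib)
  then have "(\<Sum>l\<le>CARD('n). ?c l *s w l) = 0"
    using * by (simp add: sum_subtractf)
  moreover have "?c i \<noteq> 0" using * by simp
  ultimately show thesis using that[of ?c] *(1) by blast
qed

lemma common_denominator:
  fixes c :: "'a \<Rightarrow> rat"
  assumes "finite A"
  obtains D :: int and b where "D \<noteq> 0" "\<And>i. i \<in> A \<Longrightarrow> of_int D * c i = of_int (b i)"
proof -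
  define q where "q i = snd (quotient_of (c i))" for i
  have q: "q i \<noteq> 0" "c i = of_int (fst (quotient_of (c i))) / of_int (q i)" for i
    using quotient_of_denom_pos'[of "c i"] quotient_of_div[of "c i" "fst (quotient_of (c i))" "q i"]
    by (simp_all add: q_def)
  show thesis
  proof
    show "(\<Prod>i\<in>A. q i) \<noteq> 0" using q(1) assms by simp
    fix i assume "i \<in> A"
    then have "(\<Prod>i\<in>A. q i) = q i * (\<Prod>i\<in>A - {i}. q i)" using assms by (simp add: prod.remove)
    then show "of_int (\<Prod>i\<in>A. q i) * c i = of_int (fst (quotient_of (c i)) * (\<Prod>i\<in>A - {i}. q i))"
      using q[of i] by (simp add: field_simps)
  qed
qed

text \<open>Let \<open>g\<close> have least degree among the non-zero integer polynomials vanishing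
  at \<mu>. Pseudo-division, the substitute for division over the integers, gives
  \<open>a f = g q\<close>. If \<open>g\<close> had smaller degree than \<open>f\<close>, the prime
  \<open>f\<close> would divide \<open>q\<close>; cancelling \<open>f\<close> makes \<open>g\<close>
  a non-zero constant, which has no root.\<close>

lemma irreducible_degree_le_if_common_root:
  fixes f p :: "int poly" and \<mu> :: "'a::field_char_0"
  assumes "irreducible f" "poly (map_poly of_int f) \<mu> = 0" "p \<noteq> 0" "poly (map_poly of_int p) \<mu> = 0"
  shows "degree f \<le> degree p"
proof (rule ccontr)
  let ?P = "\<lambda>p. p \<noteq> 0 \<and> poly (map_poly of_int p) \<mu> = 0"
  define g where "g = arg_min degree ?P"
  have g: "?P g" unfolding g_def by (rule arg_min_natI[of ?P p]) (use assms in auto)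
  have g_le: "degree g \<le> degree q" if "?P q" for q
    unfolding g_def by (rule arg_min_nat_le) (use that in auto)
  assume "\<not> degree f \<le> degree p"
  then have deg: "degree g < degree f" using g_le[of p] assms by simp
  obtain a q where aq: "a \<noteq> 0" "Polynomial.smult a f = g * q + pseudo_mod f g"
    using pseudo_mod(1)[of g f] g by auto
  have "poly (map_poly of_int (pseudo_mod f g)) \<mu> = 0"
  proof -
    have "pseudo_mod f g = [:a:] * f - g * q" using aq(2) by simp
    then show ?thesis using g assms(2)
      by (simp add: map_poly_of_int_diff map_poly_of_int_mult del: mult_pCons_left)
  qed
  then have "pseudo_mod f g = 0"
    using pseudo_mod(2)[of g f] g g_le[of "pseudo_mod f g"] by force
  then have gq: "Polynomial.smult a f = g * q" using aq by simp
  then have "f dvd g * q" by (metis dvd_smult dvd_refl)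
  moreover have "prime_elem f" using assms(1) by (rule irreducible_imp_prime_elem)
  moreover have "\<not> f dvd g" using dvd_imp_degree_le[of f g] g deg by auto
  ultimately have "f dvd q" by (metis prime_elem_dvd_multD)
  then obtain t where "q = f * t" by (rule dvdE)
  then have "f * [:a:] = f * (g * t)" using gq by (simp add: ac_simps)
  moreover have "f \<noteq> 0" using assms(1) by auto
  ultimately have "[:a:] = g * t" by (metis mult_cancel_left)
  then have "degree (g * t) = 0" "t \<noteq> 0" using aq(1) by (metis degree_pCons_0, auto)
  then have "degree g = 0" using g by (simp add: degree_mult_eq)
  then obtain b where "g = [:b:]" by (rule degree_eq_zeroE)
  then show False using g by (simp add: map_poly_pCons)
qed

text \<open>Pairing with \<open>v\<close> turns multiplication of row vectors by \<open>M\<close>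
  into multiplication by \<mu>. A non-trivial relation would thus make \<mu> a root of a non-zero
  integer polynomial of degree below n, against irreducibility.\<close>

lemma eigenvector_no_relation:
  fixes M :: "int^'n^'n" and v :: "complex^'n"
  assumes irr: "irreducible (char_poly M)" and v: "map_matrix of_int M *v v = \<mu> *s v" "v \<noteq> 0"
    and k: "(\<Sum>i\<in>UNIV. of_int (k $ i) * v $ i) = 0"
  shows "k = 0"
proof (rule ccontr)
  assume "k \<noteq> 0"
  define dot where "dot x = (\<Sum>i\<in>UNIV. of_int (x $ i) * v $ i)" for x :: "int^'n"
  obtain i where i: "v $ i \<noteq> 0" using v(2) by (auto simp: vec_eq_iff)
  \<comment> \<open>\<open>dot (row j) = \<mu> ^ j * v $ i\<close>, so a rational dependency between \<open>k\<close> and the \<open>n\<close> vectors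
    \<open>row j\<close>, \<open>j < n\<close>, is a polynomial of degree less than \<open>n\<close> with root \<open>\<mu>\<close>.\<close>
  define row where "row j = ((\<lambda>x. x v* M) ^^ j) (axis i 1)" for j
  have "dot (x v* M) = \<mu> * dot x" for x
  proof -
    have "dot (x v* M) = (\<Sum>l\<in>UNIV. \<Sum>m\<in>UNIV. of_int (x $ m) * (of_int (M $ m $ l) * v $ l))"
      by (simp add: dot_def vector_matrix_mult_def sum_distrib_left sum_distrib_right mult_ac)
    also have "\<dots> = (\<Sum>m\<in>UNIV. of_int (x $ m) * (map_matrix of_int M *v v) $ m)"
      by (subst sum.swap) (simp add: matrix_vector_mult_def sum_distrib_left)
    also have "\<dots> = \<mu> * dot x"
      unfolding v(1) by (simp add: dot_def sum_distrib_left mult_ac)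
    finally show ?thesis .
  qed
  moreover have "dot (axis i 1) = v $ i"
    by (simp add: dot_def axis_def if_distrib[of of_int] if_distrib[of "\<lambda>x. x * _"] cong: if_cong)
  ultimately have dot_row: "dot (row j) = \<mu> ^ j * v $ i" for j
    by (induction j) (simp_all add: row_def)
  define n where "n = CARD('n)"
  define w where "w j = (if j < n then row j else k)" for j
  obtain c where c: "(\<Sum>j\<le>n. c j *s ((\<chi> l. of_int (w j $ l)) :: rat^'n)) = 0" "\<exists>j\<le>n. c j \<noteq> 0"
    unfolding n_def by (rule rat_vec_dependent)
  obtain D b where b: "D \<noteq> 0" "\<And>j. j \<in> {..n} \<Longrightarrow> of_int D * c j = of_int (b j)"
    using common_denominator[of "{..n}" c] finite_atMost by metis
  have sum_b: "(\<Sum>j\<le>n. b j * w j $ l) = 0" for l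
  proof -
    have "(of_int (\<Sum>j\<le>n. b j * w j $ l) :: rat) = of_int D * (\<Sum>j\<le>n. c j *s ((\<chi> l. of_int (w j $ l)) :: rat^'n)) $ l"
      by (simp add: sum_distrib_left b(2)[symmetric] mult.assoc)
    then show ?thesis unfolding c(1) by (metis mult_zero_right of_int_eq_0_iff zero_index)
  qed
  \<comment> \<open>The dependency cannot involve \<open>k\<close> alone, because \<open>k\<close>
    is non-zero. This makes the polynomial \<open>p\<close> below non-zero.\<close>
  have "\<exists>j<n. b j \<noteq> 0"
  proof (rule ccontr)
    assume *: "\<not> (\<exists>j<n. b j \<noteq> 0)"
    then have "b n * k $ l = 0" for l
      using sum_b[of l] by (simp add: w_def flip: lessThan_Suc_atMost)
    then have "b n = 0" using \<open>k \<noteq> 0\<close> by (auto simp: vec_eq_iff)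
    then have "b j = 0" if "j \<le> n" for j using * that by (cases "j = n") auto
    then show False using b c(2) by force
  qed
  define p where "p = (\<Sum>j<n. monom (b j) j)"
  have coeff_p: "coeff p j = (if j < n then b j else 0)" for j
    by (simp add: p_def coeff_sum)
  have "p \<noteq> 0" using \<open>\<exists>j<n. b j \<noteq> 0\<close> coeff_p by (metis coeff_0)
  have "poly (map_poly of_int p) \<mu> * v $ i = 0"
  proof -
    have "poly (map_poly of_int p) \<mu> * v $ i = (\<Sum>j<n. of_int (b j) * dot (row j))"
      by (simp add: p_def map_poly_of_int_sum poly_sum poly_monom map_poly_monom dot_row sum_distrib_right mult.assoc)
    also have "\<dots> = (\<Sum>j\<le>n. of_int (b j) * dot (w j))"
      using k by (simp add: w_def dot_def flip: lessThan_Suc_atMost)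
    also have "\<dots> = (\<Sum>l\<in>UNIV. of_int (\<Sum>j\<le>n. b j * w j $ l) * v $ l)"
      by (simp add: dot_def sum_distrib_left sum_distrib_right mult.assoc) (rule sum.swap)
    also have "\<dots> = 0" by (simp only: sum_b) simp
    finally show ?thesis .
  qed
  then have root: "poly (map_poly of_int p) \<mu> = 0" using i by simp
  have "\<mu> \<in> spectrum (map_matrix of_int M)" using v by (auto simp: spectrum_def)
  then have "poly (map_poly of_int (char_poly M)) \<mu> = 0"
    by (simp add: spectrum_eq_roots map_poly_char_poly)
  from irreducible_degree_le_if_common_root[OF irr this \<open>p \<noteq> 0\<close> root]
  have "n \<le> degree p" by (simp add: degree_char_poly n_def)
  moreover have "degree p \<le> n - 1" by (rule degree_le) (auto simp: coeff_p)
  moreover have "n > 0" by (simp add: n_def)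
  ultimately show False by simp
qed

section \<open>Dense one-parameter subgroups of the compact torus\<close>

text \<open>Try t = x + i with x real. For each non-zero \<open>k\<close> the relation is a
  non-trivial affine equation in x and excludes at most one value; there are countably many
  \<open>k\<close> and uncountably many x.\<close>

lemma no_relation_Im_multiple:
  fixes v :: "complex^'n"
  assumes v: "\<And>k::int^'n. (\<Sum>i\<in>UNIV. of_int (k $ i) * v $ i) = 0 \<Longrightarrow> k = 0"
  obtains t where "\<And>k::int^'n. (\<Sum>i\<in>UNIV. of_int (k $ i) * Im (t * v $ i)) = 0 \<Longrightarrow> k = 0"
proof -
  define \<kappa> where "\<kappa> k = (\<Sum>i\<in>UNIV. of_int (k $ i) * v $ i)" for k :: "int^'n"
  define B where "B k = {x::real. x * Im (\<kappa> k) + Re (\<kappa> k) = 0}" for k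
  have "countable (B k)" if "k \<noteq> 0" for k
  proof -
    have "\<kappa> k \<noteq> 0" using v that by (auto simp: \<kappa>_def)
    then have "x = - Re (\<kappa> k) / Im (\<kappa> k)" if "x \<in> B k" for x
    proof -
      have "x * Im (\<kappa> k) = - Re (\<kappa> k)" "Im (\<kappa> k) \<noteq> 0"
        using that \<open>\<kappa> k \<noteq> 0\<close> by (auto simp: B_def complex_eq_iff)
      then show ?thesis by (metis nonzero_mult_div_cancel_right)
    qed
    then have "B k \<subseteq> {- Re (\<kappa> k) / Im (\<kappa> k)}" by blast
    then show ?thesis by (rule countable_subset) simp
  qed
  then have "countable (\<Union>k\<in>UNIV - {0}. B k)"
    by (intro countable_UN) auto
  then have "(\<Union>k\<in>UNIV - {0}. B k) \<noteq> UNIV"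
    using uncountable_UNIV_real by metis
  then obtain x where x: "x \<notin> (\<Union>k\<in>UNIV - {0}. B k)" by auto
  show thesis
  proof
    fix k :: "int^'n"
    assume "(\<Sum>i\<in>UNIV. of_int (k $ i) * Im (Complex x 1 * v $ i)) = 0"
    moreover have "(\<Sum>i\<in>UNIV. of_int (k $ i) * Im (Complex x 1 * v $ i)) = x * Im (\<kappa> k) + Re (\<kappa> k)"
      by (simp add: \<kappa>_def sum_distrib_left algebra_simps sum.distrib)
    ultimately show "k = 0" using x by (auto simp: B_def)
  qed
qed

text \<open>Kronecker's simultaneous approximation theorem, carried over from families on an initial
  segment of the naturals to coordinates in a finite type by an enumeration
  \<open>e\<close>.\<close>

lemma Kronecker_vec:
  fixes r \<alpha> :: "real^'n"
  assumes r: "\<And>k::int^'n. (\<Sum>i\<in>UNIV. of_int (k $ i) * r $ i) = 0 \<Longrightarrow> k = 0" and "\<epsilon> > 0"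
  obtains s and h :: "'n \<Rightarrow> int" where "\<And>i. \<bar>s * r $ i - of_int (h i) - \<alpha> $ i\<bar> < \<epsilon>"
proof -
  \<comment> \<open>With this interpretation \<open>independent\<close> means independence of real
    numbers over the integers, as in \<open>Kronecker_thm_1\<close>.\<close>
  interpret Modules.module "\<lambda>r. (*) (real_of_int r)"
    by (simp add: Modules.module.intro distrib_left mult.commute)
  obtain e where e: "bij_betw e {..<CARD('n)} (UNIV :: 'n set)"
    using ex_bij_betw_nat_finite[of "UNIV :: 'n set"] by (auto simp: atLeast0LessThan)
  \<comment> \<open>Independence of the set of entries says nothing about repeated entries; two
    equal ones would give the relation with coefficients 1 and -1.\<close>
  have inj: "inj (($) r)"
  proof (rule injI, rule ccontr)
    fix i j assume *: "r $ i = r $ j" "i \<noteq> j"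
    let ?k = "(\<chi> l. if l = i then 1 else if l = j then -1 else 0) :: int^'n"
    have "(\<Sum>l\<in>UNIV. of_int (?k $ l) * r $ l) =
        (\<Sum>l\<in>UNIV. (if l = i then r $ l else 0) + (if l = j then - r $ l else 0))"
      using * by (intro sum.cong) auto
    also have "\<dots> = 0" using * by (simp add: sum.distrib)
    finally have "?k = 0" by (rule r)
    then have "?k $ i = 0" by (metis zero_index)
    then show False by simp
  qed
  have im: "(\<lambda>i. r $ e i) ` {..<CARD('n)} = range (($) r)"
    using e by (auto simp: bij_betw_def image_image[symmetric])
  have "independent (range (($) r))"
    unfolding dependent_explicit
  proof safe
    fix t u x assume t: "finite t" "t \<subseteq> range (($) r)" "(\<Sum>v\<in>t. real_of_int (u v) * v) = 0"
      and x: "x \<in> t" "u x \<noteq> 0"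
    let ?k = "(\<chi> i. if r $ i \<in> t then u (r $ i) else 0) :: int^'n"
    have "(\<Sum>i\<in>UNIV. of_int (?k $ i) * r $ i) = (\<Sum>i | r $ i \<in> t. of_int (u (r $ i)) * r $ i)"
      by (intro sum.mono_neutral_cong_right) auto
    also have "\<dots> = (\<Sum>v\<in>t. real_of_int (u v) * v)"
      using t(2) inj by (intro sum.reindex_cong[of "($) r", symmetric]) (auto intro: inj_on_subset)
    finally have "?k = 0" using t(3) r by metis
    moreover obtain i where "x = r $ i" using x t by auto
    ultimately show False using x by (auto simp: vec_eq_iff split: if_splits)
  qed
  then have ind: "independent ((\<lambda>i. r $ e i) ` {..<CARD('n)})" by (simp add: im)
  have injre: "inj_on (\<lambda>i. r $ e i) {..<CARD('n)}"
    using e inj by (auto simp: bij_betw_def inj_on_def)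
  obtain t h where th: "\<And>i. i < CARD('n) \<Longrightarrow> \<bar>t * r $ e i - of_int (h i) - \<alpha> $ e i\<bar> < \<epsilon>"
    using Kronecker_thm_1[OF ind injre \<open>\<epsilon> > 0\<close>, of "\<lambda>i. \<alpha> $ e i"] by metis
  show thesis
  proof
    fix i :: 'n
    obtain l where "l < CARD('n)" "e l = i" using e by (auto simp: bij_betw_def image_iff) (metis UNIV_I imageE lessThan_iff)
    moreover from this have "inv_into {..<CARD('n)} e i = l"
      using e by (auto simp: bij_betw_def)
    ultimately show "\<bar>t * r $ i - of_int ((h \<circ> inv_into {..<CARD('n)} e) i) - \<alpha> $ i\<bar> < \<epsilon>"
      using th[of l] by simp
  qed
qed

lemma const_on_unit_torus_if_const_on_line:
  fixes r :: "real^'n" and f :: "complex^'n \<Rightarrow> complex"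
  assumes r: "\<And>k::int^'n. (\<Sum>i\<in>UNIV. of_int (k $ i) * r $ i) = 0 \<Longrightarrow> k = 0"
    and f: "continuous_on torus f" "\<And>s. f (\<chi> j. cis (s * r $ j)) = c"
    and z: "\<And>j. cmod (z $ j) = 1"
  shows "f z = c"
proof -
  \<comment> \<open>Angles are measured in full turns, so that the integers supplied by Kronecker's
    theorem disappear under \<open>cis\<close>.\<close>
  define \<alpha> where "\<alpha> = (\<chi> j. Arg (z $ j) / (2 * pi))"
  have z_eq: "z $ j = cis (2 * pi * \<alpha> $ j)" for j
    using z[of j] cis_Arg[of "z $ j"] by (force simp: \<alpha>_def sgn_div_norm)
  have "\<exists>s h. \<forall>j. \<bar>s * r $ j - of_int (h j :: int) - \<alpha> $ j\<bar> < 1 / real (Suc n)" for n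
    using Kronecker_vec[where r = r and \<epsilon> = "1 / real (Suc n)" and \<alpha> = \<alpha>, OF r] by (metis of_nat_0_less_iff zero_less_Suc zero_less_divide_1_iff)
  then obtain s h where sh: "\<And>n j. \<bar>s n * r $ j - of_int (h n j :: int) - \<alpha> $ j\<bar> < 1 / real (Suc n)"
    by metis
  define y where "y n = (\<chi> j. cis (2 * pi * s n * r $ j))" for n
  have "(\<lambda>n. y n $ j) \<longlonglongrightarrow> z $ j" for j
  proof -
    have "(\<lambda>n. s n * r $ j - of_int (h n j) - \<alpha> $ j) \<longlonglongrightarrow> 0"
    proof (rule Lim_null_comparison)
      show "\<forall>\<^sub>F n in sequentially. norm (s n * r $ j - of_int (h n j) - \<alpha> $ j) \<le> 1 / real (Suc n)"
        using sh[of _ j] by (auto intro!: always_eventually less_imp_le)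
      show "(\<lambda>n. 1 / real (Suc n)) \<longlonglongrightarrow> 0" by (rule LIMSEQ_Suc[OF lim_1_over_n])
    qed
    then have "(\<lambda>n. s n * r $ j - of_int (h n j)) \<longlonglongrightarrow> \<alpha> $ j" by (rule LIM_zero_cancel)
    then have "(\<lambda>n. cis (2 * pi * (s n * r $ j - of_int (h n j)))) \<longlonglongrightarrow> cis (2 * pi * \<alpha> $ j)"
      by (intro tendsto_intros)
    moreover have "cis (2 * pi * (s n * r $ j - of_int (h n j))) = y n $ j" for n
    proof -
      have "cis (2 * pi * (s n * r $ j - of_int (h n j))) =
          cis (2 * pi * s n * r $ j) / cis (2 * pi * of_int (h n j))"
        by (simp add: cis_divide algebra_simps)
      then show ?thesis by (simp add: y_def)
    qed
    ultimately show ?thesis by (simp add: z_eq)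
  qed
  then have "y \<longlonglongrightarrow> z" by (rule vec_tendstoI)
  moreover have "z \<in> torus" "\<And>n. y n \<in> torus"
    using z by (auto simp: torus_def y_def) (metis norm_zero zero_neq_one)
  ultimately have "(\<lambda>n. f (y n)) \<longlonglongrightarrow> f z"
    by (intro continuous_on_tendsto_compose[OF f(1)]) auto
  moreover have "f (y n) = c" for n using f(2)[of "2 * pi * s n"] by (simp add: y_def)
  ultimately show ?thesis by (simp add: LIMSEQ_const_iff)
qed

section \<open>Maximum modulus, chain rule and identity theorem\<close>

text \<open>A Phragmen-Lindelof principle: boundedness near the two exceptional boundary points is
  enough for the bound on the rest of the circle to hold inside. The analytic discs used later are
  undefined at exactly these two points.\<close>

lemma maximum_modulus_except_two_points:
  assumes hol: "u holomorphic_on ball 0 1" and cont: "continuous_on (cball 0 1 - {\<i>, -\<i>}) u"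
    and bdd: "\<And>z. z \<in> cball 0 1 - {\<i>, -\<i>} \<Longrightarrow> cmod (u z) \<le> B'"
    and circle: "\<And>z. z \<in> sphere 0 1 - {\<i>, -\<i>} \<Longrightarrow> cmod (u z) \<le> B"
    and "cmod \<eta> < 1"
  shows "cmod (u \<eta>) \<le> B"
proof (rule ccontr)
  assume "\<not> cmod (u \<eta>) \<le> B"
  then have gt: "B < cmod (u \<eta>)" by simp
  have "0 \<le> B" using circle[of 1] order_trans[OF norm_ge_zero[of "u 1"]] by (auto simp: complex_eq_iff)
  have neg: "z\<^sup>2 + 1 = 0 \<longleftrightarrow> z \<in> {\<i>, -\<i>}" for z :: complex
    using power2_eq_iff[of z \<i>] by (simp add: add_eq_0_iff2)
  \<comment> \<open>The factor \<open>1 + \<eta>\<^sup>2\<close> removes the two points; its effect disappears as \<open>N\<close> grows.\<close>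
  have *: "cmod (u \<eta> ^ N * (1 + \<eta>\<^sup>2)) \<le> 2 * B ^ N" for N
  proof -
    define g where "g z = (if z \<in> {\<i>, -\<i>} then 0 else u z ^ N * (1 + z\<^sup>2))" for z
    have g_hol: "g holomorphic_on ball 0 1"
    proof (rule holomorphic_transform)
      show "(\<lambda>z. u z ^ N * (1 + z\<^sup>2)) holomorphic_on ball 0 1" by (intro holomorphic_intros hol)
    qed (auto simp: g_def)
    have g_cont: "continuous_on (cball 0 1) g"
      unfolding continuous_on_eq_continuous_within
    proof
      fix z :: complex assume z: "z \<in> cball 0 1"
      show "continuous (at z within cball 0 1) g"
      proof (cases "z \<in> {\<i>, -\<i>}")
        case False
        have "continuous_on (cball 0 1 - {\<i>, -\<i>}) (\<lambda>z. u z ^ N * (1 + z\<^sup>2))"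
          by (intro continuous_intros cont)
        then have "continuous_on (cball 0 1 - {\<i>, -\<i>}) g"
          by (rule continuous_on_eq) (auto simp: g_def)
        then have "continuous (at z within (cball 0 1 - {\<i>, -\<i>})) g"
          using z False by (simp add: continuous_on_eq_continuous_within)
        moreover have "at z within (cball 0 1 - {\<i>, -\<i>}) = at z within cball 0 1"
          using z False by (intro at_within_nhd[of z "- {\<i>, -\<i>}"]) (auto intro: open_Compl)
        ultimately show ?thesis by simp
      next
        case True
        \<comment> \<open>Here \<open>u\<close> stays bounded by \<open>B'\<close> while the factor
          tends to 0, so the value 0 extends \<open>g\<close> continuously.\<close>
        have "(g \<longlongrightarrow> 0) (at z within cball 0 1)"
        proof (rule Lim_null_comparison)
          show "\<forall>\<^sub>F y in at z within cball 0 1. norm (g y) \<le> B' ^ N * cmod (1 + y\<^sup>2)"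
            unfolding eventually_at_filter
          proof (intro always_eventually allI impI)
            fix y assume y: "y \<in> cball (0::complex) 1"
            have "0 \<le> B'" using bdd[of 0] order_trans[OF norm_ge_zero[of "u 0"]] by (auto simp: complex_eq_iff)
            then show "norm (g y) \<le> B' ^ N * cmod (1 + y\<^sup>2)"
              using bdd[of y] y by (auto simp: g_def norm_mult norm_power intro!: mult_right_mono power_mono)
          qed
          have "((\<lambda>y. B' ^ N * cmod (1 + y\<^sup>2)) \<longlongrightarrow> B' ^ N * cmod (1 + z\<^sup>2)) (at z within cball 0 1)"
            by (intro tendsto_intros)
          moreover have "1 + z\<^sup>2 = 0" using True by (auto simp: power2_eq_square)
          ultimately show "((\<lambda>y. B' ^ N * cmod (1 + y\<^sup>2)) \<longlongrightarrow> 0) (at z within cball 0 1)" by simp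
        qed
        then show ?thesis using True by (simp add: continuous_within g_def)
      qed
    qed
    have "norm (g \<eta>) \<le> 2 * B ^ N"
    proof (rule maximum_modulus_frontier[where f = g and S = "ball 0 1"])
      fix z :: complex assume "z \<in> frontier (ball 0 1)"
      then have z: "z \<in> sphere 0 1" by simp
      show "norm (g z) \<le> 2 * B ^ N"
      proof (cases "z \<in> {\<i>, -\<i>}")
        case False
        have "cmod (1 + z\<^sup>2) \<le> 1 + cmod (z\<^sup>2)" by (metis norm_one norm_triangle_ineq)
        also have "\<dots> = 2" using z by (simp add: norm_power)
        finally have "cmod (u z) ^ N * cmod (1 + z\<^sup>2) \<le> B ^ N * 2"
          using circle[of z] z False \<open>0 \<le> B\<close> by (intro mult_mono power_mono) auto
        then show ?thesis using False by (simp add: g_def norm_mult norm_power mult.commute)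
      qed (use \<open>0 \<le> B\<close> in \<open>auto simp: g_def\<close>)
    qed (use g_hol g_cont assms in auto)
    moreover have "\<eta> \<noteq> \<i>" "\<eta> \<noteq> -\<i>" using assms(5) by auto
    ultimately show ?thesis by (simp add: g_def)
  qed
  \<comment> \<open>Dividing the estimate by the N-th power of \<open>cmod (u \<eta>)\<close> leaves
    a geometric sequence with ratio below 1 on the right; in the limit \<eta> would have to be i or
    -i.\<close>
  define q where "q = B / cmod (u \<eta>)"
  have q: "0 \<le> q" "q < 1" using gt \<open>0 \<le> B\<close> by (auto simp: q_def divide_less_eq_1)
  have "cmod (1 + \<eta>\<^sup>2) \<le> 2 * q ^ N" for N
  proof -
    have "cmod (u \<eta>) ^ N * cmod (1 + \<eta>\<^sup>2) \<le> 2 * B ^ N"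
      using *[of N] by (simp only: norm_mult norm_power)
    moreover have "cmod (u \<eta>) ^ N > 0" using gt \<open>0 \<le> B\<close> by (intro zero_less_power) linarith
    ultimately show ?thesis by (simp add: q_def power_divide pos_le_divide_eq mult.commute)
  qed
  moreover have "(\<lambda>N. 2 * q ^ N) \<longlonglongrightarrow> 2 * 0"
    using q by (intro tendsto_intros LIMSEQ_power_zero) auto
  ultimately have "cmod (1 + \<eta>\<^sup>2) \<le> 0"
    by (intro LIMSEQ_le_const[of "\<lambda>N. 2 * q ^ N"]) auto
  then have "\<eta>\<^sup>2 + 1 = 0" by (simp add: add.commute)
  then show False using neg[of \<eta>] assms(5) by auto
qed

text \<open>The chain rule gives a real derivative. Complex linearity of \<open>f'\<close> pulls the
  increment \<open>h\<close> out, which leaves multiplication by one complex number.\<close>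

lemma holomorphic_several_on_compose:
  fixes f :: "('n::finite) cover \<Rightarrow> complex"
  assumes f: "holomorphic_several_on f U" and "open U" "open S"
    and w: "w holomorphic_on S" and z: "\<And>j. (\<lambda>x. z x $ j) holomorphic_on S"
    and in_U: "\<And>x. x \<in> S \<Longrightarrow> (w x, z x) \<in> U"
  shows "(\<lambda>x. f (w x, z x)) holomorphic_on S"
proof (rule holomorphic_onI)
  fix x assume x: "x \<in> S"
  obtain w' where "(w has_field_derivative w') (at x)"
    using w x \<open>open S\<close> by (metis at_within_open field_differentiable_def holomorphic_on_def)
  then have w': "(w has_derivative (\<lambda>h. h * w')) (at x)"
    by (simp add: has_field_derivative_def mult_commute_abs)
  have "\<forall>j. \<exists>d. ((\<lambda>x. z x $ j) has_field_derivative d) (at x)"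
    using z x \<open>open S\<close> by (metis at_within_open field_differentiable_def holomorphic_on_def)
  then obtain d where d: "\<And>j. ((\<lambda>x. z x $ j) has_field_derivative d j) (at x)" by metis
  have z': "(z has_derivative (\<lambda>h. h *s (\<chi> j. d j))) (at x)"
  proof (rule has_derivative_componentwise_within[THEN iffD2, rule_format])
    fix b :: "complex^'n" assume "b \<in> Basis"
    then obtain j c where b: "b = axis j c" "c \<in> Basis" by (auto simp: Basis_vec_def)
    have "((\<lambda>x. z x $ j \<bullet> c) has_derivative (\<lambda>h. (h * d j) \<bullet> c)) (at x)"
      using has_derivative_inner_left[OF d[of j, unfolded has_field_derivative_def], of c]
      by (simp add: mult.commute)
    then show "((\<lambda>x. z x \<bullet> b) has_derivative (\<lambda>h. (h *s (\<chi> j. d j)) \<bullet> b)) (at x)"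
      by (simp add: b inner_axis)
  qed
  obtain f' where f': "(f has_derivative f') (at (w x, z x))" "\<And>c h k. f' (c * h, c *s k) = c * f' (h, k)"
    using f in_U[OF x] \<open>open U\<close> unfolding holomorphic_several_on_def by (metis at_within_open)
  have "((\<lambda>x. f (w x, z x)) has_derivative (\<lambda>h. f' (h * w', h *s (\<chi> j. d j)))) (at x)"
    by (rule has_derivative_compose[OF has_derivative_Pair[OF w' z'] f'(1)])
  then have "((\<lambda>x. f (w x, z x)) has_field_derivative f' (w', (\<chi> j. d j))) (at x)"
    by (simp add: f'(2) has_field_derivative_def mult.commute[of _ "f' _"])
  then show "(\<lambda>x. f (w x, z x)) field_differentiable at x within S"
    by (auto simp: field_differentiable_def intro: has_field_derivative_at_within)
qed

text \<open>Coordinates are released from the unit circle one at a time; \<open>A\<close> is the set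
  of those already free. Each release is the identity theorem in one variable on the punctured
  plane, starting from the circle.\<close>

lemma const_on_torus_if_const_on_unit_torus:
  fixes f :: "complex^'n \<Rightarrow> complex"
  assumes hol: "\<And>z i. z \<in> torus \<Longrightarrow> (\<lambda>\<zeta>. f (\<chi> j. if j = i then \<zeta> else z $ j)) holomorphic_on - {0}"
    and const: "\<And>z. (\<And>j. cmod (z $ j) = 1) \<Longrightarrow> f z = c" and "z \<in> torus"
  shows "f z = c"
proof -
  have "\<forall>z\<in>torus. (\<forall>j. j \<notin> A \<longrightarrow> cmod (z $ j) = 1) \<longrightarrow> f z = c" if "finite A" for A
    using that
  proof (induction A)
    case empty
    then show ?case using const by simp
  next
    case (insert i A)
    show ?case
    proof (intro ballI impI)
      fix z :: "complex^'n" assume z: "z \<in> torus" "\<forall>j. j \<notin> insert i A \<longrightarrow> cmod (z $ j) = 1"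
      let ?g = "\<lambda>\<zeta>. f (\<chi> j. if j = i then \<zeta> else z $ j) - c"
      have "?g (z $ i) = 0"
      proof (rule analytic_continuation[of ?g "- {0}" "sphere 0 1" 1])
        show "?g holomorphic_on - {0}" by (intro holomorphic_intros hol z)
        show "connected (- {0::complex})" by (simp add: connected_punctured_universe)
        show "(1::complex) islimpt sphere 0 1"
        proof (rule connected_imp_perfect)
          have "(1::complex) \<in> sphere 0 1" "(-1::complex) \<in> sphere 0 1" by auto
          then show "sphere (0::complex) 1 \<noteq> {x}" for x by (metis one_neq_neg_one singletonD)
        qed (auto intro: connected_sphere)
        show "?g \<zeta> = 0" if "\<zeta> \<in> sphere 0 1" for \<zeta>
        proof -
          have "(\<chi> j. if j = i then \<zeta> else z $ j) \<in> torus" using z that by (auto simp: torus_def)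
          then show ?thesis using insert.IH z that by simp
        qed
        show "z $ i \<in> - {0}" using z by (auto simp: torus_def)
      qed (auto simp: open_Compl)
      moreover have "(\<chi> j. if j = i then z $ i else z $ j) = z" by (simp add: vec_eq_iff)
      ultimately show "f z = c" by simp
    qed
  qed
  from this[of UNIV] show ?thesis using \<open>z \<in> torus\<close> by simp
qed

section \<open>The action on monomials and on one-parameter subgroups\<close>

lemma torus_act_Suc:
  assumes "invertible M" "z \<in> torus"
  shows "torus_act M (j + 1) z = phi M (torus_act M j z)"
  unfolding torus_act_def using assms by (intro int_iter_Suc bij_betw_phi)

lemma torus_act_in_torus: "invertible M \<Longrightarrow> z \<in> torus \<Longrightarrow> torus_act M j z \<in> torus"
  unfolding torus_act_def by (intro int_iter_in bij_betw_phi)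

text \<open>Each power, negative ones included, is again a monomial map with integer exponents,
  because an inverse of \<open>M\<close> over the integers undoes \<open>phi M\<close>. Monomial
  maps preserve the compact torus.\<close>

lemma torus_act_monomial:
  assumes "invertible M"
  obtains N where "\<And>z. z \<in> torus \<Longrightarrow> torus_act M j z = phi N z"
proof -
  obtain M' where M': "M' ** M = mat 1" using assms by (auto simp: invertible_def)
  have "\<exists>N. \<forall>z\<in>torus. torus_act M j z = phi N z"
  proof (induction j rule: int_induct[where k = 0])
    case base
    show ?case by (intro exI[of _ "mat 1"]) (simp add: torus_act_def int_iter_0 phi_one)
  next
    case (step1 j)
    then obtain N where "\<forall>z\<in>torus. torus_act M j z = phi N z" by blast
    then show ?case
      using torus_act_Suc[OF assms] by (intro exI[of _ "M ** N"]) (simp add: phi_mult)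
  next
    case (step2 j)
    then obtain N where N: "\<forall>z\<in>torus. torus_act M j z = phi N z" by blast
    have "torus_act M (j - 1) z = phi (M' ** N) z" if z: "z \<in> torus" for z
    proof -
      have "torus_act M (j - 1) z = phi (M' ** M) (torus_act M (j - 1) z)" by (simp add: M' phi_one)
      also have "\<dots> = phi M' (torus_act M j z)"
        using torus_act_Suc[OF assms z, of "j - 1"] torus_act_in_torus[OF assms z] by (simp add: phi_mult)
      finally show ?thesis using N z by (simp add: phi_mult)
    qed
    then show ?case by blast
  qed
  then show thesis using that by blast
qed

lemma torus_act_unit_torus:
  assumes "invertible M" "\<And>j. cmod (z $ j) = 1"
  shows "cmod (torus_act M n z $ i) = 1"
proof -
  obtain N where "\<And>z. z \<in> torus \<Longrightarrow> torus_act M n z = phi N z"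
    using torus_act_monomial[OF assms(1)] by blast
  moreover have "z \<in> torus" using assms(2) by (auto simp: torus_def) (metis norm_zero zero_neq_one)
  ultimately show ?thesis using assms(2) by (simp add: phi_def norm_power_int flip: prod_norm)
qed

text \<open>For real \<open>\<xi>\<close> the point \<open>exp_Im \<xi> v\<close> lies on the unit torus; complex \<open>\<xi>\<close> give the complexified
  one-parameter subgroup.\<close>

definition exp_Im :: "complex \<Rightarrow> complex^'n \<Rightarrow> complex^'n" where
  "exp_Im \<xi> v = (\<chi> j. exp (\<i> * \<xi> * of_real (Im (v $ j))))"

lemma exp_Im_in_torus: "exp_Im \<xi> v \<in> torus"
  by (simp add: exp_Im_def torus_def)

text \<open>The monomial map is linear in logarithmic coordinates, and a matrix with integer entries
  commutes with taking imaginary parts.\<close>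

lemma phi_exp_Im: "phi M (exp_Im \<xi> v) = exp_Im \<xi> (map_matrix of_int M *v v)"
proof -
  have "(\<Prod>j\<in>UNIV. exp (\<i> * \<xi> * of_real (Im (v $ j))) powi (M $ i $ j)) =
      exp (\<i> * \<xi> * of_real (Im (\<Sum>j\<in>UNIV. of_int (M $ i $ j) * v $ j)))" for i
    by (simp add: exp_power_int exp_sum[symmetric] sum_distrib_left mult_ac)
  then show ?thesis by (simp add: phi_def exp_Im_def matrix_vector_mult_def vec_eq_iff)
qed

text \<open>On an eigenvector the action only rescales \<open>v\<close>. The downward induction step
  cancels the injective map \<open>phi M\<close>.\<close>

lemma torus_act_exp_Im:
  assumes "invertible M" and v: "map_matrix of_int M *v v = \<mu> *s v" and "\<mu> \<noteq> 0"
  shows "torus_act M n (exp_Im \<xi> v) = exp_Im \<xi> (\<mu> powi n *s v)"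
proof (induction n rule: int_induct[where k = 0])
  case base
  show ?case by (simp add: torus_act_def int_iter_0)
next
  case (step1 n)
  have "torus_act M (n + 1) (exp_Im \<xi> v) = exp_Im \<xi> (map_matrix of_int M *v (\<mu> powi n *s v))"
    using torus_act_Suc[OF assms(1) exp_Im_in_torus] step1 by (simp add: phi_exp_Im)
  then show ?case
    using \<open>\<mu> \<noteq> 0\<close> by (simp add: matrix_vector_mult_scaleR vector_scalar_commute v power_int_add mult.commute)
next
  case (step2 n)
  have "phi M (torus_act M (n - 1) (exp_Im \<xi> v)) = exp_Im \<xi> (\<mu> powi n *s v)"
    using torus_act_Suc[OF assms(1) exp_Im_in_torus, of "n - 1"] step2 by simp
  also have "\<dots> = phi M (exp_Im \<xi> (\<mu> powi (n - 1) *s v))"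
    using \<open>\<mu> \<noteq> 0\<close> by (simp add: phi_exp_Im vector_scalar_commute v power_int_diff)
  finally show ?case
    using bij_betw_imp_inj_on[OF bij_betw_phi[OF assms(1)]]
      torus_act_in_torus[OF assms(1) exp_Im_in_torus] exp_Im_in_torus
    by (meson inj_onD)
qed

section \<open>Compact pieces of the torus and the analytic discs\<close>

text \<open>The bound \<open>C\<close> is on the logarithms of the moduli. These sets exhaust the
  torus by compact sets, and \<open>polyannulus 0\<close> is the compact torus.\<close>

definition polyannulus :: "real \<Rightarrow> (complex^'n) set" where
  "polyannulus C = {z. \<forall>j. exp (- C) \<le> cmod (z $ j) \<and> cmod (z $ j) \<le> exp C}"

lemma compact_polyannulus: "compact (polyannulus C :: (complex^'n) set)"
  unfolding compact_eq_bounded_closed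
proof
  have "norm z \<le> (\<Sum>j\<in>(UNIV::'n set). exp C)" if "z \<in> polyannulus C" for z :: "complex^'n"
    unfolding norm_vec_def
    using that by (intro order_trans[OF L2_set_le_sum sum_mono]) (auto simp: polyannulus_def)
  then show "bounded (polyannulus C :: (complex^'n) set)" by (rule boundedI)
  have "polyannulus C = (\<Inter>j. {z. exp (- C) \<le> cmod (z $ j)} \<inter> {z::complex^'n. cmod (z $ j) \<le> exp C})"
    by (auto simp: polyannulus_def)
  then show "closed (polyannulus C :: (complex^'n) set)"
    by (auto intro!: closed_INT closed_Int closed_Collect_le continuous_intros)
qed

lemma polyannulus_subset_torus: "polyannulus C \<subseteq> torus"
proof
  fix z :: "complex^'n" assume "z \<in> polyannulus C"
  then have "0 < cmod (z $ j)" for j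
    using less_le_trans[OF exp_gt_zero] unfolding polyannulus_def by blast
  then show "z \<in> torus" by (simp add: torus_def)
qed

lemma holomorphic_several_on_imp_continuous_on:
  "holomorphic_several_on f U \<Longrightarrow> continuous_on U f"
  unfolding holomorphic_several_on_def continuous_on_eq_continuous_within
  by (metis has_derivative_continuous)

lemma norm_exp_Im:
  assumes "norm \<xi> * norm (v $ j) \<le> C"
  shows "exp (- C) \<le> cmod (exp_Im \<xi> v $ j)" "cmod (exp_Im \<xi> v $ j) \<le> exp C"
proof -
  have "\<bar>Im \<xi> * Im (v $ j)\<bar> \<le> norm \<xi> * norm (v $ j)"
    unfolding abs_mult by (intro mult_mono abs_Im_le_cmod) auto
  then have "\<bar>Im \<xi> * Im (v $ j)\<bar> \<le> C" using assms by linarith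
  then show "exp (- C) \<le> cmod (exp_Im \<xi> v $ j)" "cmod (exp_Im \<xi> v $ j) \<le> exp C"
    by (auto simp: exp_Im_def)
qed

text \<open>On the closed disc the real part is at least twice the square of
  \<open>Re \<eta>\<close>, and it vanishes only at i and -i. Elsewhere the principal logarithm of
  \<open>1 + \<eta>\<^sup>2\<close> is therefore holomorphic with imaginary part of modulus below
  pi/2.\<close>

lemma Re_one_plus_square_pos:
  assumes "\<eta> \<in> cball 0 1 - {\<i>, -\<i>}"
  shows "0 < Re (1 + \<eta>\<^sup>2)"
proof -
  have le: "(Re \<eta>)\<^sup>2 + (Im \<eta>)\<^sup>2 \<le> 1"
    using assms by (simp add: cmod_def real_le_lsqrt)
  have "(Re \<eta>)\<^sup>2 > 0 \<or> (Im \<eta>)\<^sup>2 < 1"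
  proof (rule ccontr)
    assume "\<not> ?thesis"
    then have "Re \<eta> = 0" "(Im \<eta>)\<^sup>2 = 1" using le by (auto simp: not_less)
    then have "\<eta> = \<i> \<or> \<eta> = -\<i>" by (auto simp: complex_eq_iff power2_eq_1_iff)
    then show False using assms by auto
  qed
  moreover have "Re (1 + \<eta>\<^sup>2) = 1 + (Re \<eta>)\<^sup>2 - (Im \<eta>)\<^sup>2" by (simp add: power2_eq_square)
  moreover have "(Re \<eta>)\<^sup>2 \<ge> 0" by simp
  ultimately show ?thesis using le by linarith
qed

text \<open>On the unit circle the quotient is the inverse of \<eta> plus its conjugate. At i and -i
  it is 0 by the convention for division by zero.\<close>

lemma Im_divide_one_plus_square:
  assumes "cmod \<eta> = 1"
  shows "Im (\<eta> / (1 + \<eta>\<^sup>2)) = 0"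
proof -
  have "\<eta> * cnj \<eta> = 1" using assms by (simp add: complex_norm_square[symmetric])
  then have "\<eta> / (1 + \<eta>\<^sup>2) = \<eta> / (\<eta> * (cnj \<eta> + \<eta>))"
    by (simp add: algebra_simps power2_eq_square)
  also have "\<dots> = 1 / of_real (2 * Re \<eta>)"
    using assms by (auto simp: complex_add_cnj add.commute)
  also have "\<dots> = of_real (1 / (2 * Re \<eta>))" by simp
  finally show ?thesis by (simp only: Im_complex_of_real)
qed

text \<open>Each disc is centred over \<open>exp_Im 0 v\<close> and at parameter 1/R passes close to
  \<open>exp_Im 1 v\<close>. The Schwarz lemma bounds the difference of the values by a constant
  times 1/R, and R tends to infinity.\<close>

lemma invariant_function_constant_on_line:
  fixes f :: "('n::finite) cover \<Rightarrow> complex" and M :: "int^'n^'n"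
  assumes hol: "holomorphic_several_on f (strip m \<times> torus)"
    and inv: "\<And>j w z. w \<in> strip m \<Longrightarrow> z \<in> torus \<Longrightarrow> f (w + of_int j, torus_act M j z) = f (w, z)"
    and M: "invertible M" and v: "map_matrix of_int M *v v = \<mu> *s v" and \<mu>: "1 < cmod \<mu>"
    and m: "pi / (2 * ln (cmod \<mu>)) < m / (4 * pi)"
  shows "f (of_real x, exp_Im 1 v) = f (of_real x, exp_Im 0 v)"
proof -
  define L where "L = ln (cmod \<mu>)"
  \<comment> \<open>This bounds the imaginary part of the first disc component: the logarithm
    contributes less than pi/2, divided by \<open>L\<close>. The hypothesis on \<open>m\<close> puts
    \<open>h\<close> below half the width of the strip.\<close>
  define h where "h = pi / (2 * L)"
  have "L > 0" unfolding L_def using \<mu> by (rule ln_gt_zero)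
  have exp_L: "cmod \<mu> = exp L" using \<mu> exp_ln[of "cmod \<mu>"] unfolding L_def by linarith
  have "\<mu> \<noteq> 0" using \<mu> by auto
  have in_strip: "w \<in> strip m" if "\<bar>Im w\<bar> \<le> h" for w
    using m that by (simp add: strip_def h_def L_def)
  have cont: "continuous_on (strip m \<times> torus) f"
    using hol by (rule holomorphic_several_on_imp_continuous_on)

  \<comment> \<open>The action moves \<open>Re w\<close> into the unit interval, so that compactness
    of \<open>Q \<times> polyannulus C\<close> bounds \<open>f\<close> at points with arbitrary real
    part.\<close>
  have "\<exists>B. \<forall>w z. \<bar>Im w\<bar> \<le> h \<longrightarrow> z \<in> torus \<longrightarrow> torus_act M (- \<lfloor>Re w\<rfloor>) z \<in> polyannulus C \<longrightarrow>
      cmod (f (w, z)) \<le> B" for C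
  proof -
    define Q where "Q = cbox (Complex 0 (-h)) (Complex 1 h)"
    have "Q \<times> polyannulus C \<subseteq> strip m \<times> (torus :: (complex^'n) set)"
      using polyannulus_subset_torus[of C] in_strip by (auto simp: Q_def in_cbox_complex_iff)
    then have "compact (f ` (Q \<times> polyannulus C))"
      by (intro compact_continuous_image continuous_on_subset[OF cont] compact_Times compact_polyannulus)
        (simp_all add: Q_def)
    then obtain B where B: "\<And>y. y \<in> f ` (Q \<times> polyannulus C) \<Longrightarrow> cmod y \<le> B"
      using compact_imp_bounded bounded_iff by metis
    have "cmod (f (w, z)) \<le> B"
      if "\<bar>Im w\<bar> \<le> h" "z \<in> torus" "torus_act M (- \<lfloor>Re w\<rfloor>) z \<in> polyannulus C" for w z
    proof -
      have "f (w, z) = f (w + of_int (- \<lfloor>Re w\<rfloor>), torus_act M (- \<lfloor>Re w\<rfloor>) z)"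
        using inv[OF in_strip[OF that(1)] that(2)] by metis
      moreover have "w + of_int (- \<lfloor>Re w\<rfloor>) \<in> Q"
        using that(1) by (auto simp: Q_def in_cbox_complex_iff abs_le_iff) linarith+
      ultimately show ?thesis using B that(3) by (metis SigmaI imageI)
    qed
    then show ?thesis by blast
  qed
  then obtain bd where bd: "\<And>C w z. \<lbrakk>\<bar>Im w\<bar> \<le> h; z \<in> torus;
      torus_act M (- \<lfloor>Re w\<rfloor>) z \<in> polyannulus C\<rbrakk> \<Longrightarrow> cmod (f (w, z)) \<le> bd C"
    by metis
  \<comment> \<open>The compact torus is invariant under the action, so over it this one bound
    serves for every \<open>Re w\<close>.\<close>
  define B where "B = bd 0"
  have B: "cmod (f (w, z)) \<le> B" if "\<bar>Im w\<bar> \<le> h" "\<And>j. cmod (z $ j) = 1" for w z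
  proof -
    have "z \<in> torus" using that(2) by (auto simp: torus_def) (metis norm_zero zero_neq_one)
    then show ?thesis
      using that torus_act_unit_torus[OF M that(2)] by (auto simp: B_def polyannulus_def intro!: bd)
  qed

  \<comment> \<open>The analytic disc of radius \<open>R\<close>: on the unit circle \<open>\<eta> / (1 + \<eta>\<^sup>2)\<close> is real, so the boundary lies over the
    unit torus and \<open>B\<close> is a bound that does not depend on \<open>R\<close>. At \<open>\<plusminus>\<i>\<close> the torus component escapes, but so does
    \<open>Re w\<close>, at the rate at which \<open>M\<close> to the power \<open>-\<lfloor>Re w\<rfloor>\<close> contracts; the disc stays in a bounded set modulo the action.\<close>
  have disc: "cmod (f (of_real x - Ln (1 + \<eta>\<^sup>2) / of_real L, exp_Im (of_real R * (\<eta> / (1 + \<eta>\<^sup>2))) v)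
      - f (of_real x, exp_Im 0 v)) \<le> (2 * B + 1) * cmod \<eta>"
    if "0 < R" "cmod \<eta> < 1" for R \<eta>
  proof -
    define w where "w \<eta> = of_real x - Ln (1 + \<eta>\<^sup>2) / of_real L" for \<eta> :: complex
    define \<xi> where "\<xi> \<eta> = of_real R * (\<eta> / (1 + \<eta>\<^sup>2))" for \<eta> :: complex
    define u where "u \<eta> = f (w \<eta>, exp_Im (\<xi> \<eta>) v)" for \<eta>
    define D where "D = {\<eta>::complex. 0 < Re (1 + \<eta>\<^sup>2)}"
    have sub: "cball 0 1 - {\<i>, -\<i>} \<subseteq> D" using Re_one_plus_square_pos by (auto simp: D_def)
    then have ball_sub: "ball 0 1 \<subseteq> D" by force
    have ne: "1 + \<eta>\<^sup>2 \<notin> \<real>\<^sub>\<le>\<^sub>0" "1 + \<eta>\<^sup>2 \<noteq> 0" if "\<eta> \<in> D" for \<eta>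
      using that by (auto simp: D_def complex_nonpos_Reals_iff complex_eq_iff)
    have Im_w: "\<bar>Im (w \<eta>)\<bar> < h" if "\<eta> \<in> D" for \<eta>
    proof -
      have "\<bar>Im (Ln (1 + \<eta>\<^sup>2))\<bar> < pi / 2"
        using that Re_Ln_pos_lt[OF ne(2)[OF that]] by (simp add: D_def)
      then show ?thesis using \<open>L > 0\<close> by (simp add: w_def h_def field_simps)
    qed
    have u_hol: "u holomorphic_on D"
      unfolding u_def
    proof (rule holomorphic_several_on_compose[OF hol])
      show "open (strip m \<times> (torus :: (complex^'n) set))" by (intro open_Times open_strip open_torus)
      show "open D" unfolding D_def by (intro open_Collect_less continuous_intros)
      show "w holomorphic_on D"
        unfolding w_def using ne \<open>L > 0\<close> by (intro holomorphic_intros) auto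
      show "(\<lambda>\<eta>. exp_Im (\<xi> \<eta>) v $ j) holomorphic_on D" for j
        unfolding \<xi>_def exp_Im_def vec_lambda_beta using ne by (intro holomorphic_intros) auto
      show "(w \<eta>, exp_Im (\<xi> \<eta>) v) \<in> strip m \<times> torus" if "\<eta> \<in> D" for \<eta>
        using in_strip Im_w[OF that] exp_Im_in_torus by auto
    qed
    have u_le: "cmod (u \<eta>) \<le> B" if "cmod \<eta> < 1" for \<eta>
    proof (rule maximum_modulus_except_two_points[OF _ _ _ _ that])
      show "u holomorphic_on ball 0 1" using u_hol ball_sub by (rule holomorphic_on_subset)
      show "continuous_on (cball 0 1 - {\<i>, -\<i>}) u"
        using holomorphic_on_imp_continuous_on[OF u_hol] sub by (rule continuous_on_subset)
      fix \<eta> assume \<eta>: "\<eta> \<in> cball 0 1 - {\<i>, -\<i>}"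
      let ?n = "\<lfloor>Re (w \<eta>)\<rfloor>" and ?y = "1 + \<eta>\<^sup>2"
      have y: "?y \<noteq> 0" using ne(2) sub \<eta> by blast
      \<comment> \<open>Since \<open>Re w\<close> is x minus \<open>ln (cmod ?y) / L\<close>, this
        power is of order \<open>cmod ?y\<close> and cancels the growth of \<xi>, which is at most R
        divided by \<open>cmod ?y\<close>. The floor costs only a factor
        \<open>exp L\<close>.\<close>
      have "cmod (\<mu> powi - ?n) = exp (L * of_int (- ?n))"
        by (simp add: norm_power_int exp_L exp_power_int mult.commute del: of_int_minus)
      also have "\<dots> \<le> exp (L * (1 - Re (w \<eta>)))"
      proof -
        have "of_int (- ?n) \<le> 1 - Re (w \<eta>)" by linarith
        then show ?thesis using \<open>L > 0\<close> by (simp only: exp_le_cancel_iff mult_le_cancel_left_pos)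
      qed
      also have "L * (1 - Re (w \<eta>)) = L - L * x + ln (cmod ?y)"
        using y \<open>L > 0\<close> by (simp add: w_def field_simps)
      also have "exp (L - L * x + ln (cmod ?y)) = exp (L - L * x) * cmod ?y"
        using y by (simp add: exp_add)
      finally have 1: "cmod (\<mu> powi - ?n) \<le> exp (L - L * x) * cmod ?y" .
      have 2: "cmod (\<xi> \<eta>) \<le> R / cmod ?y"
        using \<eta> \<open>0 < R\<close> by (simp add: \<xi>_def norm_mult norm_divide divide_right_mono mult_left_le)
      have 3: "cmod (\<xi> \<eta>) * cmod ((\<mu> powi - ?n *s v) $ j) \<le> R * exp (L - L * x) * norm v" for j
      proof -
        have "cmod (\<xi> \<eta>) * cmod (\<mu> powi - ?n) \<le> (R / cmod ?y) * (exp (L - L * x) * cmod ?y)"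
          using 1 2 \<open>0 < R\<close> by (intro mult_mono) auto
        also have "\<dots> = R * exp (L - L * x)" using y by simp
        finally show ?thesis
          using mult_mono[OF _ Finite_Cartesian_Product.norm_nth_le[of v j]] \<open>0 < R\<close> by (simp add: norm_mult flip: mult.assoc)
      qed
      \<comment> \<open>This bound depends on R; it enters only as the \<open>B'\<close> of the
        maximum principle.\<close>
      show "cmod (u \<eta>) \<le> bd (R * exp (L - L * x) * norm v)"
        unfolding u_def
      proof (rule bd)
        show "\<bar>Im (w \<eta>)\<bar> \<le> h" using Im_w sub \<eta> by (blast intro: less_imp_le)
        show "torus_act M (- ?n) (exp_Im (\<xi> \<eta>) v) \<in> polyannulus (R * exp (L - L * x) * norm v)"
          unfolding torus_act_exp_Im[OF M v \<open>\<mu> \<noteq> 0\<close>] polyannulus_def using norm_exp_Im[OF 3] by blast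
      qed (rule exp_Im_in_torus)
    next
      fix \<eta> assume \<eta>: "\<eta> \<in> sphere (0::complex) 1 - {\<i>, -\<i>}"
      then have "\<eta> \<in> D" using sub by auto
      moreover have "Im (\<xi> \<eta>) = 0"
        unfolding \<xi>_def using Im_divide_one_plus_square[of \<eta>] \<eta> by (simp add: Im_complex_div_eq_0 del: times_divide_eq_right)
      ultimately show "cmod (u \<eta>) \<le> B"
        unfolding u_def using Im_w by (intro B) (auto simp: exp_Im_def less_imp_le)
    qed
    have "0 \<le> B" using order_trans[OF norm_ge_zero u_le[of 0]] by simp
    \<comment> \<open>The numerator has modulus at most 2B; the extra 1 gives the strict inequality
      in the Schwarz lemma and keeps the denominator non-zero when B = 0.\<close>
    define g where "g \<eta> = (u \<eta> - u 0) / of_real (2 * B + 1)" for \<eta>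
    have "cmod (g \<eta>) \<le> cmod \<eta>"
    proof (rule Schwarz_Lemma(1))
      show "g holomorphic_on ball 0 1"
        unfolding g_def using \<open>0 \<le> B\<close>
        by (intro holomorphic_intros holomorphic_on_subset[OF u_hol ball_sub])
          (simp del: of_real_add)
      show "cmod (g \<eta>) < 1" if "cmod \<eta> < 1" for \<eta>
      proof -
        have "cmod (u \<eta> - u 0) \<le> cmod (u \<eta>) + cmod (u 0)" by (rule norm_triangle_ineq4)
        then have "cmod (u \<eta> - u 0) < 2 * B + 1" using u_le[OF that] u_le[of 0] by simp
        then show ?thesis using \<open>0 \<le> B\<close> by (simp add: g_def norm_divide del: of_real_add)
      qed
    qed (use \<open>cmod \<eta> < 1\<close> in \<open>simp_all add: g_def\<close>)
    moreover have "u 0 = f (of_real x, exp_Im 0 v)" by (simp add: u_def w_def \<xi>_def)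
    ultimately show ?thesis
      using \<open>0 \<le> B\<close>
      by (simp add: g_def norm_divide pos_divide_le_eq u_def w_def \<xi>_def mult.commute del: of_real_add)
  qed

  \<comment> \<open>These are the parameters \<eta> = 1/R. The double successor keeps them inside
    the open disc; with R = 1/q the torus parameter becomes \<open>1 / (1 + q\<^sup>2)\<close> and
    tends to 1.\<close>
  define q where "q n = 1 / real (Suc (Suc n))" for n
  define W where "W n = complex_of_real x - Ln (1 + (of_real (q n))\<^sup>2) / of_real L" for n
  define Z where "Z n = exp_Im (1 / (1 + (of_real (q n))\<^sup>2)) v" for n
  have q: "0 < q n" "q n < 1" for n by (simp_all add: q_def)
  have q_lim: "q \<longlonglongrightarrow> 0"
    unfolding q_def using LIMSEQ_Suc[OF LIMSEQ_Suc[OF lim_1_over_n]] by simp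
  have lim_0: "(\<lambda>n. cmod (f (W n, Z n) - f (of_real x, exp_Im 0 v))) \<longlonglongrightarrow> 0"
  proof (rule Lim_null_comparison)
    have "cmod (f (W n, Z n) - f (of_real x, exp_Im 0 v)) \<le> (2 * B + 1) * q n" for n
      using disc[of "1 / q n" "of_real (q n)"] q[of n] by (simp add: W_def Z_def)
    then show "\<forall>\<^sub>F n in sequentially.
        norm (cmod (f (W n, Z n) - f (of_real x, exp_Im 0 v))) \<le> (2 * B + 1) * q n"
      by (intro always_eventually) simp
    show "(\<lambda>n. (2 * B + 1) * q n) \<longlonglongrightarrow> 0" using tendsto_mult_right_zero[OF q_lim] .
  qed
  have "(\<lambda>n. cmod (f (W n, Z n) - f (of_real x, exp_Im 0 v)))
      \<longlonglongrightarrow> cmod (f (of_real x, exp_Im 1 v) - f (of_real x, exp_Im 0 v))"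
  proof -
    have q_lim': "(\<lambda>n. complex_of_real (q n)) \<longlonglongrightarrow> 0" using tendsto_of_real[OF q_lim] by simp
    have "W \<longlonglongrightarrow> of_real x - Ln (1 + 0\<^sup>2) / of_real L"
      unfolding W_def using \<open>L > 0\<close> by (intro tendsto_intros q_lim') auto
    moreover have "Z \<longlonglongrightarrow> exp_Im (1 / (1 + 0\<^sup>2)) v"
      unfolding Z_def exp_Im_def by (intro tendsto_intros q_lim') auto
    ultimately have lim: "(\<lambda>n. (W n, Z n)) \<longlonglongrightarrow> (of_real x, exp_Im 1 v)"
      by (simp add: tendsto_Pair)
    have in_dom: "(of_real x, exp_Im 1 v) \<in> strip m \<times> torus"
      using in_strip[of "of_real x"] \<open>L > 0\<close> exp_Im_in_torus[of 1 v] by (simp add: h_def)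
    moreover have "open (strip m \<times> (torus :: (complex^'n) set))" by (intro open_Times open_strip open_torus)
    ultimately have "isCont f (of_real x, exp_Im 1 v)"
      using cont by (simp add: continuous_on_eq_continuous_at)
    then show ?thesis by (intro tendsto_intros isCont_tendsto_compose[OF _ lim])
  qed
  from LIMSEQ_unique[OF this lim_0] show ?thesis by simp
qed

section \<open>Invariant functions are constant on the fibres\<close>

lemma connected_strip: "connected (strip m)"
proof -
  have "strip m = Im -` {- (m / (4 * pi))<..<m / (4 * pi)}" by (auto simp: strip_def)
  then have "convex (strip m)"
    by (simp add: convex_linear_vimage bounded_linear.linear[OF bounded_linear_Im] convex_real_interval)
  then show ?thesis by (rule convex_connected)
qed

lemma torus_act_invariant:
  assumes "invertible M"
    and inv: "\<And>w z. w \<in> strip m \<Longrightarrow> z \<in> torus \<Longrightarrow> f (w + 1, phi M z) = f (w, z)"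
    and "w \<in> strip m" "z \<in> torus"
  shows "f (w + of_int j, torus_act M j z) = f (w, z)"
proof (induction j rule: int_induct[where k = 0])
  case base
  show ?case by (simp add: torus_act_def int_iter_0)
next
  case (step1 j)
  then show ?case
    using inv[of "w + of_int j" "torus_act M j z"] assms torus_act_in_torus[OF assms(1,4)]
    by (simp add: torus_act_Suc strip_add_int add.assoc)
next
  case (step2 j)
  have "f (w + of_int (j - 1) + 1, phi M (torus_act M (j - 1) z)) = f (w + of_int (j - 1), torus_act M (j - 1) z)"
    using assms torus_act_in_torus[OF assms(1,4)] by (intro inv) (simp_all only: strip_add_int)
  then show ?case
    using step2 torus_act_Suc[OF assms(1,4), of "j - 1"] by simp
qed

text \<open>For real \<open>w\<close> constancy spreads from a line to the compact torus by density,
  and from there to the whole torus by the identity theorem. A last use of the identity theorem, in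
  \<open>w\<close>, passes from real points to the strip.\<close>

lemma invariant_function_constant_on_fibres:
  fixes f :: "('n::finite) cover \<Rightarrow> complex" and M :: "int^'n^'n"
  assumes hol: "holomorphic_several_on f (strip m \<times> torus)"
    and inv: "\<And>w z. w \<in> strip m \<Longrightarrow> z \<in> torus \<Longrightarrow> f (w + 1, phi M z) = f (w, z)"
    and M: "invertible M" and v: "map_matrix of_int M *v v = \<mu> *s v" and \<mu>: "1 < cmod \<mu>"
    and m: "pi / (2 * ln (cmod \<mu>)) < m / (4 * pi)"
    and no_rel: "\<And>k::int^'n. (\<Sum>i\<in>UNIV. of_int (k $ i) * v $ i) = 0 \<Longrightarrow> k = 0"
    and w: "w \<in> strip m" and z: "z \<in> torus"
  shows "f (w, z) = f (w, \<chi> j. 1)"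
proof -
  have "0 < pi / (2 * ln (cmod \<mu>))" using ln_gt_zero[OF \<mu>] by (intro divide_pos_pos) auto
  then have m_pos: "0 < m / (4 * pi)" using m by linarith
  then have real_in: "of_real x \<in> strip m" for x by (simp add: strip_def)
  have open_dom: "open (strip m \<times> (torus :: (complex^'n) set))" by (intro open_Times open_strip open_torus)
  have inv_act: "f (w + of_int j, torus_act M j z) = f (w, z)" if "w \<in> strip m" "z \<in> torus" for j w z
    using torus_act_invariant[OF M inv that] .
  have real: "f (of_real x, z) = f (of_real x, \<chi> j. 1)" if z: "z \<in> torus" for x z
  proof (rule const_on_torus_if_const_on_unit_torus[OF _ _ z])
    show "(\<lambda>\<zeta>. f (of_real x, \<chi> j. if j = i then \<zeta> else y $ j)) holomorphic_on - {0}"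
      if "y \<in> torus" for y :: "complex^'n" and i
    proof (rule holomorphic_several_on_compose[OF hol open_dom])
      show "(\<lambda>\<zeta>. (\<chi> j. if j = i then \<zeta> else y $ j) $ j) holomorphic_on - {0}" for j
        by (cases "j = i") (auto intro: holomorphic_intros)
    qed (use that real_in in \<open>auto simp: torus_def open_Compl\<close>)
  next
    fix y :: "complex^'n" assume y: "\<And>j. cmod (y $ j) = 1"
    obtain t where t: "\<And>k::int^'n. (\<Sum>i\<in>UNIV. of_int (k $ i) * Im (t * v $ i)) = 0 \<Longrightarrow> k = 0"
      using no_relation_Im_multiple[OF no_rel] by blast
    define r where "r = (\<chi> i. Im (t * v $ i))"
    show "f (of_real x, y) = f (of_real x, \<chi> j. 1)"
    proof (rule const_on_unit_torus_if_const_on_line[where r = r and f = "\<lambda>y. f (of_real x, y)", OF _ _ _ y])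
      show "k = 0" if "(\<Sum>i\<in>UNIV. of_int (k $ i) * r $ i) = 0" for k :: "int^'n"
        using t that by (simp add: r_def)
      show "continuous_on torus (\<lambda>y. f (of_real x, y))"
        using real_in
        by (intro continuous_on_compose2[OF holomorphic_several_on_imp_continuous_on[OF hol]] continuous_intros) auto
      show "f (of_real x, \<chi> j. cis (s * r $ j)) = f (of_real x, \<chi> j. 1)" for s
      proof -
        \<comment> \<open>Every multiple of \<open>v\<close> is an eigenvector for the same \<mu>;
          letting \<open>s\<close> vary traces out the whole line in direction
          \<open>r\<close>.\<close>
        let ?v = "(of_real s * t) *s v"
        have "map_matrix of_int M *v ?v = \<mu> *s ?v"
          by (simp add: vector_scalar_commute v mult.commute)
        from invariant_function_constant_on_line[OF hol inv_act M this \<mu> m]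
        have "f (of_real x, exp_Im 1 ?v) = f (of_real x, exp_Im 0 ?v)" .
        moreover have "exp_Im 1 ?v = (\<chi> j. cis (s * r $ j))"
          by (simp add: exp_Im_def r_def cis_conv_exp mult.assoc)
        ultimately show ?thesis by (simp add: exp_Im_def)
      qed
    qed
  qed
  \<comment> \<open>Now \<open>z\<close> is fixed. The difference vanishes on a real segment, which
    has an accumulation point in the connected strip.\<close>
  have "f (w, z) - f (w, \<chi> j. 1) = 0"
  proof (rule analytic_continuation[where f = "\<lambda>w. f (w, z) - f (w, \<chi> j. 1)" and S = "strip m"
        and U = "closed_segment 0 1" and \<xi> = 0])
    show "(\<lambda>w. f (w, z) - f (w, \<chi> j. 1)) holomorphic_on strip m"
      using z
      by (intro holomorphic_on_diff holomorphic_several_on_compose[OF hol open_dom open_strip])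
        (auto simp: torus_def)
    show "0 islimpt closed_segment 0 (1::complex)"
    proof (rule connected_imp_perfect)
      show "closed_segment 0 (1::complex) \<noteq> {a}" for a
        by (metis ends_in_segment(1) ends_in_segment(2) singletonD zero_neq_one)
    qed auto
    have seg: "\<exists>x. w = of_real x" if "w \<in> closed_segment 0 1" for w :: complex
      using that by (auto simp: in_segment scaleR_conv_of_real)
    then show "closed_segment 0 1 \<subseteq> strip m" using real_in by auto
    show "f (w, z) - f (w, \<chi> j. 1) = 0" if "w \<in> closed_segment 0 1" for w
      using seg[OF that] real[OF z] by auto
    show "0 \<in> strip m" using real_in[of 0] by simp
  qed (use w open_strip connected_strip in auto)
  then show ?thesis by simp
qed

section \<open>An eigenvector that realises \<open>rho M\<close>\<close>

lemma matrix_inv_both: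
  assumes "invertible M"
  shows "M ** matrix_inv M = mat 1" "matrix_inv M ** M = mat 1"
  using someI_ex[OF assms[unfolded invertible_def]] by (auto simp: matrix_inv_def)

lemma map_matrix_of_int_mult:
  "map_matrix of_int (A ** B) = (map_matrix of_int A ** map_matrix of_int B :: 'a::ring_1^'n^'m)"
  by (simp add: matrix_matrix_mult_def vec_eq_iff)

text \<open>An eigenvector of the inverse for \<mu> is one of \<open>M\<close> for
  \<open>inverse \<mu>\<close>. In both cases the independence of its entries thus comes from the
  irreducible characteristic polynomial of \<open>M\<close> itself.\<close>

lemma rho_eigenvector:
  fixes M :: "int^'n^'n"
  assumes M: "invertible M" and irr: "irreducible (char_poly M)"
  obtains N \<mu> v where "N = M \<or> N = matrix_inv M" "map_matrix of_int N *v v = \<mu> *s v" "cmod \<mu> = rho M"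
    "\<And>k::int^'n. (\<Sum>i\<in>UNIV. of_int (k $ i) * v $ i) = 0 \<Longrightarrow> k = 0"
proof (cases "rho M = spectral_radius (map_matrix of_int M)")
  case True
  then obtain \<mu> v where "map_matrix of_int M *v v = \<mu> *s v" "v \<noteq> 0" "cmod \<mu> = rho M"
    by (metis spectral_radius_attained)
  then show thesis using that[of M] eigenvector_no_relation[OF irr] by blast
next
  case False
  let ?N = "matrix_inv M"
  have "rho M = spectral_radius (map_matrix of_int ?N)" using False unfolding rho_def max_def by metis
  then obtain \<mu> v where v: "map_matrix of_int ?N *v v = \<mu> *s v" "v \<noteq> 0" "cmod \<mu> = rho M"
    by (metis spectral_radius_attained)
  have "map_matrix of_int M *v (\<mu> *s v) = map_matrix of_int (M ** ?N) *v v"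
    by (simp add: v(1)[symmetric] map_matrix_of_int_mult matrix_vector_mul_assoc)
  also have "\<dots> = v"
  proof -
    have "map_matrix of_int (mat 1 :: int^'n^'n) = (mat 1 :: complex^'n^'n)"
      by (simp add: mat_def vec_eq_iff)
    then show ?thesis by (simp add: matrix_inv_both[OF M])
  qed
  finally have *: "\<mu> *s (map_matrix of_int M *v v) = v" by (simp add: vector_scalar_commute)
  then have "\<mu> \<noteq> 0" using v(2) by auto
  then have "map_matrix of_int M *v v = inverse \<mu> *s v"
    using arg_cong[OF *, of "\<lambda>x. inverse \<mu> *s x"] by (simp add: vector_smult_assoc)
  then show thesis using that[of ?N] v eigenvector_no_relation[OF irr] by blast
qed

section \<open>Holomorphy on the covering and descent to the annulus\<close>

lemma holomorphic_several_on_fst: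
  fixes T :: "(complex^'n) set"
  assumes "g holomorphic_on S" "open S"
  shows "holomorphic_several_on (\<lambda>x. g (fst x)) (S \<times> T)"
  unfolding holomorphic_several_on_def
proof
  fix x :: "'n cover" assume "x \<in> S \<times> T"
  then obtain g' where "(g has_field_derivative g') (at (fst x))"
    using assms by (metis field_differentiable_def holomorphic_on_imp_differentiable_at mem_Times_iff)
  then have "((\<lambda>x. g (fst x)) has_derivative (\<lambda>h. g' * fst h)) (at x)"
    unfolding has_field_derivative_def
    by (rule has_derivative_compose[OF has_derivative_fst[OF has_derivative_ident]])
  then show "\<exists>f'. ((\<lambda>x. g (fst x)) has_derivative f') (at x within S \<times> T) \<and>
      (\<forall>c h k. f' (c * h, c *s k) = c * f' (h, k))"
    by (intro exI[of _ "\<lambda>h. g' * fst h"]) (auto intro: has_derivative_at_withinI)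
qed

text \<open>The strip is symmetric under \<open>w\<close> to \<open>-w\<close>, and this reflection
  exchanges the actions of \<open>M\<close> and its inverse. It serves the case in which the inverse
  has the larger spectral radius.\<close>

lemma holomorphic_several_on_uminus_fst:
  fixes T :: "(complex^'n) set"
  assumes "holomorphic_several_on f (strip m \<times> T)"
  shows "holomorphic_several_on (\<lambda>x. f (- fst x, snd x)) (strip m \<times> T)"
  unfolding holomorphic_several_on_def
proof
  let ?s = "\<lambda>x :: 'n cover. (- fst x, snd x)"
  fix x :: "'n cover" assume x: "x \<in> strip m \<times> T"
  have maps: "?s ` (strip m \<times> T) \<subseteq> strip m \<times> T" by (auto simp: strip_def)
  then obtain f' where f': "(f has_derivative f') (at (?s x) within strip m \<times> T)"
      "\<And>c h k. f' (c * h, c *s k) = c * f' (h, k)"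
    using assms x unfolding holomorphic_several_on_def by blast
  have "((\<lambda>x. f (?s x)) has_derivative (\<lambda>h. f' (?s h))) (at x within strip m \<times> T)"
    by (rule has_derivative_in_compose[OF _ has_derivative_subset[OF f'(1) maps]])
      (auto intro!: derivative_eq_intros)
  moreover have "f' (?s (c * h, c *s k)) = c * f' (?s (h, k))" for c h k
    using f'(2)[of c "- h" k] by simp
  ultimately show "\<exists>f'. ((\<lambda>x. f (- fst x, snd x)) has_derivative f') (at x within strip m \<times> T) \<and>
      (\<forall>c h k. f' (c * h, c *s k) = c * f' (h, k))"
    by (intro exI[of _ "\<lambda>h. f' (?s h)"]) simp
qed

lemma strip_to_annulus_holomorphic: "strip_to_annulus m holomorphic_on S"
  unfolding strip_to_annulus_def by (intro holomorphic_intros)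

lemma strip_to_annulus_in_iff: "strip_to_annulus m w \<in> annulus m \<longleftrightarrow> w \<in> strip m"
proof
  assume "strip_to_annulus m w \<in> annulus m"
  then obtain w' where "w' \<in> strip m" "strip_to_annulus m w = strip_to_annulus m w'"
    using strip_to_annulus_image[of m] by (metis imageE)
  then show "w \<in> strip m" by (metis strip_to_annulus_eq_iff strip_add_int)
qed (use strip_to_annulus_image in blast)

text \<open>Periodicity makes the value independent of the chosen preimage, and local branches of
  the logarithm show that the resulting function is holomorphic.\<close>

lemma periodic_descends_to_annulus:
  assumes k: "k holomorphic_on strip m" and per: "\<And>w j. w \<in> strip m \<Longrightarrow> k (w + of_int j) = k w"
  obtains g where "g holomorphic_on annulus m" "\<And>w. w \<in> strip m \<Longrightarrow> g (strip_to_annulus m w) = k w"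
proof -
  define g where "g y = k (SOME w. strip_to_annulus m w = y)" for y
  have g: "g (strip_to_annulus m w) = k w" if "w \<in> strip m" for w
  proof -
    have "strip_to_annulus m (SOME w'. strip_to_annulus m w' = strip_to_annulus m w) = strip_to_annulus m w"
      by (rule someI) simp
    then obtain j :: int where "(SOME w'. strip_to_annulus m w' = strip_to_annulus m w) = w + of_int j"
      by (metis strip_to_annulus_eq_iff)
    then show ?thesis using per[OF that] by (simp add: g_def)
  qed
  have open_annulus: "open (annulus m)"
    unfolding annulus_def by (intro open_Collect_conj open_Collect_less continuous_intros)
  have "g field_differentiable at y within annulus m" if y: "y \<in> annulus m" for y
  proof -
    obtain w where w: "w \<in> strip m" "strip_to_annulus m w = y"
      using y strip_to_annulus_image[of m] by (metis imageE)
    have "y \<noteq> 0" using y by (auto simp: annulus_def)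
    \<comment> \<open>The local inverse of the covering that sends \<open>y\<close> to
      \<open>w\<close>. It is holomorphic on \<open>U\<close>, where \<open>u / y\<close> stays in
      the right half-plane.\<close>
    define l where "l u = w + Ln (u / y) / (2 * of_real pi * \<i>)" for u
    define U where "U = {u \<in> annulus m. 0 < Re (u / y)}"
    have "open U"
      unfolding U_def Collect_conj_eq
      by (intro open_Int open_Collect_less continuous_intros) (use open_annulus \<open>y \<noteq> 0\<close> in auto)
    have "y \<in> U" using y \<open>y \<noteq> 0\<close> by (simp add: U_def)
    have l: "strip_to_annulus m (l u) = u" if "u \<in> U" for u
    proof -
      have "u \<noteq> 0" using that by (auto simp: U_def)
      have "strip_to_annulus m (l u) = strip_to_annulus m w * exp (Ln (u / y))"
        by (simp add: strip_to_annulus_def l_def algebra_simps flip: exp_add)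
      then show ?thesis using w \<open>y \<noteq> 0\<close> \<open>u \<noteq> 0\<close> by simp
    qed
    have l_in: "l u \<in> strip m" if "u \<in> U" for u
      using l[OF that] that strip_to_annulus_in_iff[of m "l u"] by (simp add: U_def)
    have "u / y \<notin> \<real>\<^sub>\<le>\<^sub>0" if "u \<in> U" for u
      using that by (auto simp: U_def complex_nonpos_Reals_iff)
    then have "l holomorphic_on U"
      unfolding l_def using \<open>y \<noteq> 0\<close> by (intro holomorphic_intros) auto
    then have "(k \<circ> l) holomorphic_on U"
      using k l_in by (intro holomorphic_on_compose_gen[of l U k "strip m"]) auto
    then have "g holomorphic_on U"
      by (rule holomorphic_transform) (metis comp_apply g l l_in)
    then show ?thesis
      using \<open>open U\<close> \<open>y \<in> U\<close> field_differentiable_at_within holomorphic_on_imp_differentiable_at by blast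
  qed
  then show thesis using that[of g] g by (auto simp: holomorphic_on_def)
qed

lemma E_class_act:
  assumes "invertible M" "w \<in> strip m" "z \<in> torus"
  shows "E_class m M (w + 1, phi M z) = E_class m M (w, z)"
proof -
  have "torus_act M 1 z = phi M z"
    using torus_act_Suc[OF assms(1,3), of 0] by (simp add: torus_act_def int_iter_0)
  then have "((w, z), (w + 1, phi M z)) \<in> orbit_rel m M"
    using assms by (auto simp: orbit_rel_def intro!: exI[of _ 1])
  then show ?thesis
    unfolding E_class_def using equiv_class_eq[OF equiv_orbit_rel[OF assms(1)]] by metis
qed

section \<open>The pull-back as an isomorphism of algebras\<close>

theorem theorem2:
  fixes M :: "int^'d^'d" and m :: real
  assumes "2 \<le> CARD('d)"
    and "invertible M"
    and "rho M > 1"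
    and "m > 0"
    and "irreducible (char_poly M)"
    and "m * ln (rho M) > 2 * pi\<^sup>2"
  shows "(\<lambda>g. compose (E m M) g (E_proj m)) \<in> algebra_iso (O_annulus m) (O_E m M)"
proof -
  note M = \<open>invertible M\<close>
  let ?p = "\<lambda>g. compose (E m M) g (E_proj m)"
  have proj_in: "E_proj m X \<in> annulus m" if "X \<in> E m M" for X
    using that E_proj_image[OF M] by blast
  have m_bound: "pi / (2 * ln (rho M)) < m / (4 * pi)"
    using assms(6) ln_gt_zero[OF assms(3)] by (simp add: field_simps power2_eq_square)
  have holomorphic: "holomorphic_wrt (E_atlas m M) (?p g)" if "g holomorphic_on annulus m" for g
  proof -
    have "(g \<circ> strip_to_annulus m) holomorphic_on strip m"
      using that strip_to_annulus_image
      by (intro holomorphic_on_compose_gen[OF strip_to_annulus_holomorphic]) auto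
    then have "holomorphic_several_on (\<lambda>x. (g \<circ> strip_to_annulus m) (fst x)) (strip m \<times> (torus :: (complex^'d) set))"
      by (rule holomorphic_several_on_fst[OF _ open_strip])
    moreover have "(?p g \<circ> E_class m M) x = (g \<circ> strip_to_annulus m) (fst x)" if "x \<in> strip m \<times> torus" for x
      using that E_proj_class[OF M] by (auto simp: compose_def E_eq)
    ultimately show ?thesis
      unfolding holomorphic_E_iff[OF M]
      using holomorphic_several_on_cong[of "strip m \<times> torus" "?p g \<circ> E_class m M" "\<lambda>x. (g \<circ> strip_to_annulus m) (fst x)"]
      by blast
  qed
  \<comment> \<open>The lift \<open>F\<close> of \<open>f\<close> is constant in the torus variable,
    so its restriction to the section through the unit point descends to the required function on
    the annulus.\<close>
  have surj: "\<exists>g\<in>carrier (O_annulus m). ?p g = f" if f: "f \<in> carrier (O_E m M)" for f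
  proof -
    define F where "F = f \<circ> E_class m M"
    have hol: "holomorphic_several_on F (strip m \<times> torus)"
      using f holomorphic_E_iff[OF M] by (simp add: F_def O_E_def fun_algebra_def)
    have inv: "F (w + 1, phi M z) = F (w, z)" if "w \<in> strip m" "z \<in> torus" for w z
      using E_class_act[OF M that] by (simp add: F_def)
    obtain N \<mu> v where N: "N = M \<or> N = matrix_inv M" "map_matrix of_int N *v v = \<mu> *s v" "cmod \<mu> = rho M"
      and v: "\<And>k::int^'d. (\<Sum>i\<in>UNIV. of_int (k $ i) * v $ i) = 0 \<Longrightarrow> k = 0"
      using rho_eigenvector[OF M assms(5)] by metis
    have \<mu>: "1 < cmod \<mu>" "pi / (2 * ln (cmod \<mu>)) < m / (4 * pi)"
      using N(3) assms(3) m_bound by simp_all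
    have fibre: "F (w, z) = F (w, \<chi> j. 1)" if w: "w \<in> strip m" and z: "z \<in> torus" for w z
      using N(1)
    proof
      assume "N = M"
      then show ?thesis
        using invariant_function_constant_on_fibres[OF hol inv M _ \<mu> v w z] N(2) by blast
    next
      assume N': "N = matrix_inv M"
      note NM = matrix_inv_both[OF M, folded N']
      \<comment> \<open>The reflected function is invariant under the action of \<open>N\<close>, so
        the fibre lemma applies to it at \<open>- w\<close>.\<close>
      have "F (- fst (- w, z), snd (- w, z)) = F (- fst (- w, (\<chi> j. 1) :: complex^'d), snd (- w, \<chi> j. 1))"
      proof (rule invariant_function_constant_on_fibres[where f = "\<lambda>x. F (- fst x, snd x)", OF holomorphic_several_on_uminus_fst[OF hol] _ _ N(2) \<mu> v _ z])
        show "invertible N" using NM by (auto simp: invertible_def)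
        show "- w \<in> strip m" using w by (simp add: strip_def)
        fix w' and z' :: "complex^'d" assume *: "w' \<in> strip m" "z' \<in> torus"
        then have "F (- (w' + 1) + 1, phi M (phi N z')) = F (- (w' + 1), phi N z')"
          by (intro inv phi_in_torus) (simp add: strip_def)
        then show "F (- fst (w' + 1, phi N z'), snd (w' + 1, phi N z')) = F (- fst (w', z'), snd (w', z'))"
          using * by (simp add: phi_mult NM phi_one)
      qed
      then show ?thesis by simp
    qed
    have one: "(\<chi> j. 1) \<in> (torus :: (complex^'d) set)" by (simp add: torus_def)
    have holomorphic_1: "(\<lambda>w. F (w, \<chi> j. 1)) holomorphic_on strip m"
      using one
      by (intro holomorphic_several_on_compose[OF hol open_Times[OF open_strip open_torus] open_strip]) auto
    \<comment> \<open>Translation by \<open>j\<close> also moves the unit point by the action;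
      constancy on the fibre over \<open>w + j\<close> brings it back.\<close>
    have periodic_1: "F (w + of_int j, \<chi> j. 1) = F (w, \<chi> j. 1)" if "w \<in> strip m" for w j
      using torus_act_invariant[OF M inv that one, of j] fibre[OF _ torus_act_in_torus[OF M one, of j], of "w + of_int j"]
        that by (simp add: strip_add_int)
    obtain g where g: "g holomorphic_on annulus m"
        "\<And>w. w \<in> strip m \<Longrightarrow> g (strip_to_annulus m w) = F (w, \<chi> j. 1)"
      using periodic_descends_to_annulus[OF holomorphic_1 periodic_1] by blast
    \<comment> \<open>Elements of the algebra are extensional, whereas \<open>g\<close> may take any
      values off the annulus.\<close>
    have "restrict g (annulus m) \<in> carrier (O_annulus m)"
      using g(1) holomorphic_transform[of g "annulus m" "restrict g (annulus m)"]
      by (simp add: O_annulus_def fun_algebra_def)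
    moreover have "?p (restrict g (annulus m)) = f"
    proof (rule extensionalityI[of _ "E m M"])
      show "f \<in> extensional (E m M)" using f by (simp add: O_E_def fun_algebra_def)
      fix X assume X: "X \<in> E m M"
      then obtain w z where wz: "X = E_class m M (w, z)" "w \<in> strip m" "z \<in> torus" by (auto simp: E_eq)
      then have "g (E_proj m X) = F (w, z)"
        using E_proj_class[OF M] g(2) fibre by metis
      then show "?p (restrict g (annulus m)) X = f X"
        using X wz(1) proj_in[OF X] by (simp add: compose_def F_def)
    qed simp
    ultimately show ?thesis by blast
  qed
  \<comment> \<open>Pull-back along the surjection \<open>E_proj\<close> determines the function on
    the whole annulus.\<close>
  have inj: "inj_on ?p (carrier (O_annulus m))"
  proof (rule inj_onI)
    fix g g' assume *: "g \<in> carrier (O_annulus m)" "g' \<in> carrier (O_annulus m)" "?p g = ?p g'"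
    show "g = g'"
    proof (rule extensionalityI[of _ "annulus m"])
      fix y assume "y \<in> annulus m"
      then obtain X where "X \<in> E m M" "y = E_proj m X" using E_proj_image[OF M, of m] by (metis imageE)
      then show "g y = g' y" using fun_cong[OF *(3), of X] by (simp add: compose_def)
    qed (use * in \<open>simp_all add: O_annulus_def fun_algebra_def\<close>)
  qed
  have "?p \<in> carrier (O_annulus m) \<rightarrow> carrier (O_E m M)"
    using holomorphic by (auto simp: O_annulus_def O_E_def fun_algebra_def)
  moreover from this have "bij_betw ?p (carrier (O_annulus m)) (carrier (O_E m M))"
    using inj surj unfolding bij_betw_def by blast
  ultimately show ?thesis
    using proj_in unfolding algebra_iso_def ring_iso_def ring_hom_def
    by (auto simp: O_annulus_def O_E_def fun_algebra_def compose_def fun_eq_iff)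
qed

end
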